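(* Fix $\beta\in[0,2)$ and let $\sigma = 2\sqrt{2-\beta}\,\pi$. For a positive integer $N_1$ let $p_j = -\exp\!\big(-\sigma(\sqrt{N_1}-\sqrt{j}\,)\big)$, $1\le j\le N_1$. Assume, with $h=(2-\beta)\pi^2$ and $T=\sqrt{N_t h/4}$, that there is a constant $K$ such that for all sufficiently large positive integers $N_t$ and all $z = r e^{\pm i\beta\pi/2}$ with $r\in[e^{4+2\beta-2T},1]$, $$\left|\int_\Gamma f(u,z)\,\delta(u)\,du\right| \le K e^{-T},$$ with $f,\delta,\Gamma$ as in the context. Then there exist coefficients $a_1,\dots,a_{N_1}$ and a polynomial $b$ of degree $N_2=\mathcal{O}(\sqrt{N_1}\,)$ such that, with $N=N_1+N_2$, the rational function $r(z)=\sum_{j=1}^{N_1}\frac{a_j}{z-p_j}+b(z)$ satisfies $$|r(z)-\sqrt{z}\,| = \mathcal{O}\big(e^{-\pi\sqrt{(2-\beta)N}}\big)$$ as $N\to\infty$, uniformly for $z\in\{re^{i\beta\pi/2}: r\in[0,1]\}\cup\{re^{-i\beta\pi/2}: r\in[0,1]\}$.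
   Context: Here $\sqrt{\cdot}$ denotes the principal branch of the square root. For $u,z\in\mathbb{C}$, $f(u,z) = \frac{z}{\pi}\,\frac{1}{\sqrt{u}}\,\frac{e^{\sqrt{u}-T}}{e^{2(\sqrt{u}-T)}+z}$. The function $\delta(u)=\mu(u)-m(u)$, where $\mu(u)=-\tfrac12$ if $\operatorname{Im}u\ge 0$ and $\mu(u)=\tfrac12$ if $\operatorname{Im}u<0$, and $m(u) = -\tfrac{i}{2}\cot(\pi u/h)$. For $z=re^{\pm i\beta\pi/2}$, the contour $\Gamma$ is the positively oriented boundary of the rectangle $\{u: 1-\beta/2\le \operatorname{Re}u\le 4T^2+1-\beta/2,\ |\operatorname{Im}u|\le a\}$ with $a = 2\pi(T+\tfrac12\log r)$. *)

theory Defs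
  imports "HOL-Complex_Analysis.Complex_Analysis" "HOL-Computational_Algebra.Polynomial"
begin

definition hpar :: "real \<Rightarrow> real" where
  "hpar \<beta> = (2 - \<beta>) * pi ^ 2"

definition Tpar :: "real \<Rightarrow> nat \<Rightarrow> real" where
  "Tpar \<beta> Nt = sqrt (real Nt * hpar \<beta> / 4)"

definition f_fun :: "real \<Rightarrow> complex \<Rightarrow> complex \<Rightarrow> complex" where
  "f_fun T u z = z / complex_of_real pi * (1 / csqrt u)
     * exp (csqrt u - complex_of_real T) / (exp (2 * (csqrt u - complex_of_real T)) + z)"

definition mu_fun :: "complex \<Rightarrow> complex" where
  "mu_fun u = (if Im u \<ge> 0 then - 1/2 else 1/2)"

definition m_fun :: "real \<Rightarrow> complex \<Rightarrow> complex" where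
  "m_fun h u = - (\<i> / 2) * cot (complex_of_real pi * u / complex_of_real h)"

definition delta_fun :: "real \<Rightarrow> complex \<Rightarrow> complex" where
  "delta_fun h u = mu_fun u - m_fun h u"

definition rect_boundary :: "real \<Rightarrow> real \<Rightarrow> real \<Rightarrow> real \<Rightarrow> complex" where
  "rect_boundary x0 x1 a =
     linepath (Complex x0 (-a)) (Complex x1 (-a)) +++
     linepath (Complex x1 (-a)) (Complex x1 a) +++
     linepath (Complex x1 a) (Complex x0 a) +++
     linepath (Complex x0 a) (Complex x0 (-a))"

definition Gamma_contour :: "real \<Rightarrow> real \<Rightarrow> real \<Rightarrow> real \<Rightarrow> complex" where
  "Gamma_contour \<beta> T r =
     rect_boundary (1 - \<beta>/2) (4 * T ^ 2 + 1 - \<beta>/2) (2 * pi * (T + ln r / 2))"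

definition rays :: "real \<Rightarrow> complex set" where
  "rays \<beta> = {complex_of_real r * exp (complex_of_real s * \<i> * complex_of_real (\<beta> * pi / 2)) | r s.
                r \<in> {0..1} \<and> s \<in> {-1, 1}}"

definition pole :: "real \<Rightarrow> nat \<Rightarrow> nat \<Rightarrow> complex" where
  "pole \<beta> N1 j = complex_of_real (- exp (- (2 * sqrt (2 - \<beta>) * pi) * (sqrt (real N1) - sqrt (real j))))"

end

theory Submission
  imports Defs
begin

text \<open>
  The substitution \<open>x = exp (sqrt u - T)\<close> turns the integral of \<open>f(u, z)\<close> over \<open>u > 0\<close> into
  \<open>2 z / pi\<close> times the integral of \<open>1 / (x^2 + z)\<close>, so it equals \<open>sqrt z\<close> up to \<open>O(exp (-T))\<close>.
  By the residue theorem, \<open>m\<close> reproduces the trapezoidal sum with step \<open>h\<close> and \<open>\<mu>\<close> the integral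
  itself; hence the integral of \<open>f \<delta>\<close> is the quadrature error plus contributions
  \<open>residue * \<delta>\<close> of the two poles of \<open>f\<close> inside the rectangle, and the step \<open>h\<close> is such that these
  are also \<open>O(exp (-T))\<close>. For \<open>|z|\<close> of order \<open>exp (-2 T)\<close> both the sum and \<open>sqrt z\<close> are that small.
  With \<open>4 N1\<close> nodes, the sum is a rational function of \<open>z\<close> whose first \<open>N1\<close> poles are the prescribed
  ones, while the remaining ones lie in \<open>(-\<infinity>, -1)\<close>, away from the rays, so that their partial
  fractions are replaced by polynomials of degree \<open>O(sqrt N1)\<close>.
\<close>

subsection \<open>Preliminaries on residues and the complex arctangent\<close>

text \<open>The factor 4 in the number of nodes balances the two truncations. The variable
  \<open>u\<close> runs up to about \<open>4 T^2\<close>, so \<open>x\<close> runs from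
  \<open>O(exp (-T))\<close> to at least \<open>exp T\<close>, and each end cuts off
  \<open>O(exp (-T))\<close>. With \<open>4 N1\<close> nodes \<open>T = sqrt (h N1)\<close>: node
  \<open>N1\<close> sits at \<open>x = 1\<close>, its pole is \<open>-1\<close>, and
  \<open>exp (-T)\<close> is the target rate with \<open>N1\<close> in place of \<open>N\<close>.
  Adding \<open>N2 = O(sqrt N1)\<close> to \<open>N1\<close> moves the square root by a bounded
  amount, so it costs only a constant factor. The nodes beyond \<open>N1\<close> carry weights as
  large as a multiple of \<open>exp T\<close>. Geometric convergence therefore has to be pushed to
  order \<open>exp (-3 T)\<close>, and degree \<open>O(T)\<close> achieves this. The obstacle to a
  single use of the residue theorem is that \<mu> jumps across the real axis, on which the nodes
  lie. The part with \<mu> is integrated over the two half-rectangles, the part with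
  \<open>m\<close> over the whole rectangle. Uniformity rests on
  \<open>\<bar>\<theta>\<bar> < pi\<close>: half the angle stays below a right angle, and its cosine
  enters the constants.\<close>

lemma residue_quotient_simple_zero:
  assumes "open S" "p \<in> S" "(\<lambda>w. f w / g w) holomorphic_on S - {p}"
    and "isCont f p" "(g has_field_derivative g') (at p)" "g p = 0" "g' \<noteq> 0"
  shows "residue (\<lambda>w. f w / g w) p = f p / g'"
proof (rule residue_simple'[OF assms(1-3)])
  have "((\<lambda>w. (g w - g p) / (w - p)) \<longlongrightarrow> g') (at p)"
    using assms(5) by (simp add: has_field_derivative_iff)
  then have "((\<lambda>w. f w / ((g w - g p) / (w - p))) \<longlongrightarrow> f p / g') (at p)"
    using assms(4,7) by (intro tendsto_divide) (auto simp: isCont_def)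
  then show "((\<lambda>w. f w / g w * (w - p)) \<longlongrightarrow> f p / g') (at p)"
    using assms(6) by simp
qed

text \<open>The conclusion includes integrability, which is needed later when the boundary is cut
  into sides and integrals are subtracted. \<open>S\<close> has to be a neighbourhood of the closed
  rectangle that contains no singularity other than \<open>pts\<close>.\<close>

lemma has_contour_integral_rectpath_residues:
  assumes "open S" "connected S" "cbox a b \<subseteq> S" "Re a < Re b" "Im a < Im b"
    and "finite pts" "pts \<subseteq> box a b" "F holomorphic_on S - pts"
  shows "(F has_contour_integral (2 * pi * \<i> * (\<Sum>p\<in>pts. residue F p))) (rectpath a b)"
proof -
  have im: "path_image (rectpath a b) \<subseteq> S - pts"
    using assms(3-5,7) path_image_rectpath_cbox_minus_box[of a b] by auto
  have "contour_integral (rectpath a b) F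
      = 2 * pi * \<i> * (\<Sum>p\<in>pts. winding_number (rectpath a b) p * residue F p)"
  proof (rule Residue_theorem[OF assms(1,2,6,8) valid_path_rectpath _ im])
    show "\<forall>w. w \<notin> S \<longrightarrow> winding_number (rectpath a b) w = 0"
      using assms(3-5) by (meson less_imp_le subsetD winding_number_rectpath_outside)
  qed simp
  also have "(\<Sum>p\<in>pts. winding_number (rectpath a b) p * residue F p) = (\<Sum>p\<in>pts. residue F p)"
    using assms(7) by (intro sum.cong refl) (simp add: subset_eq winding_number_rectpath)
  finally have "contour_integral (rectpath a b) F = 2 * pi * \<i> * (\<Sum>p\<in>pts. residue F p)" .
  moreover have "F contour_integrable_on rectpath a b"
    using assms(1,6,8) im
    by (intro contour_integrable_holomorphic_simple[of F "S - pts"] open_Diff finite_imp_closed)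
       simp_all
  ultimately show ?thesis
    by (metis has_contour_integral_integral)
qed

text \<open>Write \<open>1 + \<zeta>^2 = \<zeta> (\<zeta> + 1 / \<zeta>)\<close>. Inversion
  preserves the sector \<open>\<kappa> \<bar>\<zeta>\<bar> \<le> Re \<zeta>\<close>, so the two
  summands cannot cancel: the real parts add up to at least
  \<open>\<kappa> (\<bar>\<zeta>\<bar> + 1 / \<bar>\<zeta>\<bar>)\<close>.\<close>

lemma norm_one_plus_square_ge:
  fixes \<zeta> :: complex
  assumes "\<kappa> * norm \<zeta> \<le> Re \<zeta>" "\<kappa> \<le> 1"
  shows "\<kappa> \<le> norm (1 + \<zeta>\<^sup>2)"
proof (cases "\<zeta> = 0")
  case False
  have "Re (inverse \<zeta>) = Re \<zeta> / (norm \<zeta>)\<^sup>2"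
    by (simp add: cmod_power2)
  moreover have "\<kappa> / norm \<zeta> = \<kappa> * norm \<zeta> / (norm \<zeta>)\<^sup>2"
    using False by (simp add: power2_eq_square)
  ultimately have "Re (inverse \<zeta>) \<ge> \<kappa> / norm \<zeta>"
    using assms by (simp only: divide_right_mono zero_le_power2)
  then have "\<kappa> * norm \<zeta> + \<kappa> / norm \<zeta> \<le> Re (\<zeta> + inverse \<zeta>)"
    using assms by simp
  also have "\<dots> \<le> norm (\<zeta> + inverse \<zeta>)"
    by (rule complex_Re_le_cmod)
  also have "\<dots> = norm (1 + \<zeta>\<^sup>2) / norm \<zeta>"
    using False by (simp add: norm_divide[symmetric] add_divide_distrib power2_eq_square inverse_eq_divide add.commute)
  finally have "(\<kappa> * norm \<zeta> + \<kappa> / norm \<zeta>) * norm \<zeta> \<le> norm (1 + \<zeta>\<^sup>2)"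
    using False by (simp only: pos_le_divide_eq zero_less_norm_iff not_False_eq_True)
  then have "\<kappa> * (norm \<zeta>)\<^sup>2 + \<kappa> \<le> norm (1 + \<zeta>\<^sup>2)"
    using False by (simp add: distrib_right power2_eq_square)
  show ?thesis
  proof (cases "\<kappa> \<ge> 0")
    case True
    then have "0 \<le> \<kappa> * (norm \<zeta>)\<^sup>2" by simp
    then show ?thesis using \<open>\<kappa> * (norm \<zeta>)\<^sup>2 + \<kappa> \<le> _\<close> by linarith
  next
    case False
    then show ?thesis
      using norm_ge_zero[of "1 + \<zeta>\<^sup>2"] by linarith
  qed
qed (use assms in auto)

text \<open>Mean value bound on the segment from 0 to \<zeta>. The segment stays in the sector,
  where the derivative \<open>1 / (1 + w^2)\<close> is at most \<open>1 / \<kappa>\<close>.\<close>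

lemma norm_Arctan_le:
  assumes "\<kappa> > 0" "\<kappa> * norm \<zeta> \<le> Re \<zeta>" "\<kappa> \<le> 1"
  shows "norm (Arctan \<zeta>) \<le> norm \<zeta> / \<kappa>"
proof -
  have sec: "\<kappa> * norm w \<le> Re w" if w: "w \<in> closed_segment 0 \<zeta>" for w
  proof -
    obtain t where t: "0 \<le> t" "w = t *\<^sub>R \<zeta>"
      using w by (auto simp: in_segment)
    then show ?thesis
      using mult_left_mono[OF assms(2) t(1)] by (simp add: mult_ac)
  qed
  have "norm (Arctan \<zeta> - Arctan 0) \<le> (1 / \<kappa>) * norm (\<zeta> - 0)"
  proof (rule field_differentiable_bound[of "closed_segment 0 \<zeta>" Arctan "\<lambda>w. inverse (1 + w\<^sup>2)"])
    fix w assume w: "w \<in> closed_segment 0 \<zeta>"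
    \<comment> \<open>The cuts of \<open>Arctan\<close> lie on the imaginary axis from
      \<open>\<plusminus> i\<close> outwards, and the sector meets that axis only at 0.\<close>
    have "w = 0" if "Re w = 0"
      using sec[OF w] that assms(1) by (metis norm_le_zero_iff mult_le_cancel_left_pos mult_zero_right)
    then have "\<bar>Im w\<bar> < 1" if "Re w = 0"
      using that by auto
    then show "(Arctan has_field_derivative inverse (1 + w\<^sup>2)) (at w within closed_segment 0 \<zeta>)"
      by (rule has_field_derivative_at_within[OF has_field_derivative_Arctan])
    show "norm (inverse (1 + w\<^sup>2)) \<le> 1 / \<kappa>"
      using norm_one_plus_square_ge[OF sec[OF w] assms(3)] assms(1)
      by (simp add: norm_inverse divide_inverse le_imp_inverse_le)
  qed auto
  then show ?thesis by simp
qed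

text \<open>The sum of both arctangents has derivative zero on the right half-plane, which is
  connected, and its value at 1 is twice \<open>pi / 4\<close>.\<close>

lemma Arctan_inverse:
  assumes "Re \<zeta> > 0"
  shows "Arctan (inverse \<zeta>) = pi / 2 - Arctan \<zeta>"
proof -
  define S where "S = {w::complex. 0 < Re w}"
  have S: "convex S" "open S" "S \<noteq> {}"
    unfolding S_def using convex_halfspace_Re_gt[of 0] open_halfspace_Re_gt[of 0]
    by (auto intro!: exI[of _ 1])
  have "\<exists>c. \<forall>w\<in>S. Arctan w + Arctan (inverse w) = c"
  proof (rule has_field_derivative_zero_constant[OF S(1)])
    fix w assume w: "w \<in> S"
    then have nz: "w \<noteq> 0" "Re w > 0" by (auto simp: S_def)
    have iw: "Re (inverse w) > 0"
      using nz by (simp add: divide_pos_pos sum_power2_gt_zero_iff)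
    have "((\<lambda>w. Arctan w + Arctan (inverse w)) has_field_derivative
        (inverse (1 + w\<^sup>2) + inverse (1 + (inverse w)\<^sup>2) * (- (inverse w * inverse w)))) (at w)"
      using nz iw
      by (intro DERIV_add has_field_derivative_Arctan
            DERIV_chain'[where f = inverse and g = Arctan] DERIV_inverse'[OF DERIV_ident, THEN DERIV_cong])
         auto
    moreover have "inverse (1 + (inverse w)\<^sup>2) * (inverse w * inverse w) = inverse (1 + w\<^sup>2)"
    proof -
      have "(1 + (inverse w)\<^sup>2) * (w * w) = 1 + w\<^sup>2"
        using nz by (simp add: field_simps power2_eq_square)
      then show ?thesis by (metis inverse_mult_distrib)
    qed
    ultimately have "((\<lambda>w. Arctan w + Arctan (inverse w)) has_field_derivative 0) (at w)"
      by (metis add.right_inverse mult_minus_right)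
    then show "((\<lambda>w. Arctan w + Arctan (inverse w)) has_field_derivative 0) (at w within S)"
      by (rule has_field_derivative_at_within)
  qed
  then obtain c where c: "\<And>w. w \<in> S \<Longrightarrow> Arctan w + Arctan (inverse w) = c"
    by blast
  have "c = Arctan (of_real 1) + Arctan (of_real 1)"
    using c[of 1] by (simp add: S_def)
  also have "\<dots> = pi / 2"
    unfolding Arctan_of_real arctan_one by (simp flip: of_real_add)
  finally show ?thesis
    using c[of \<zeta>] assms by (simp add: S_def algebra_simps)
qed

section \<open>Points at signed angle \<theta>: square root and distance to the negative
  axis\<close>

definition ray_point :: "real \<Rightarrow> real \<Rightarrow> complex" where
  "ray_point r \<theta> = complex_of_real r * exp (\<i> * complex_of_real \<theta>)"

lemma norm_ray_point: "r \<ge> 0 \<Longrightarrow> norm (ray_point r \<theta>) = r"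
  by (simp add: ray_point_def norm_mult)

lemma csqrt_ray_point:
  assumes "r > 0" "\<bar>\<theta>\<bar> < pi"
  shows "csqrt (ray_point r \<theta>) = of_real (sqrt r) * exp (\<i> * of_real (\<theta> / 2))"
proof (rule csqrt_unique)
  show "(of_real (sqrt r) * exp (\<i> * of_real (\<theta> / 2)))\<^sup>2 = ray_point r \<theta>"
    using assms unfolding power_mult_distrib exp_double[symmetric] of_real_power[symmetric]
    by (simp add: ray_point_def)
  have "cos (\<theta> / 2) > 0"
    using assms by (intro cos_gt_zero_pi) auto
  then show "0 < Re (of_real (sqrt r) * exp (\<i> * of_real (\<theta> / 2))) \<or>
      Re (of_real (sqrt r) * exp (\<i> * of_real (\<theta> / 2))) = 0 \<and>
      0 \<le> Im (of_real (sqrt r) * exp (\<i> * of_real (\<theta> / 2)))"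
    using assms by (simp add: Re_exp)
qed

text \<open>Rotating by \<open>-\<theta> / 2\<close> places the two summands symmetrically about the
  real axis, at angles \<open>-\<theta> / 2\<close> and \<open>\<theta> / 2\<close>. Each then has
  real part \<open>cos (\<theta> / 2)\<close> times its modulus.\<close>

lemma norm_add_ray_point_ge:
  assumes "x \<ge> 0" "r \<ge> 0"
  shows "cos (\<theta> / 2) * (x + r) \<le> norm (of_real x + ray_point r \<theta>)"
proof -
  have e: "exp (- (\<i> * of_real (\<theta> / 2))) * exp (\<i> * of_real \<theta>) = exp (\<i> * of_real (\<theta> / 2))"
    by (simp flip: exp_add add: field_simps)
  have "cos (\<theta> / 2) * (x + r) = Re (of_real x * exp (- (\<i> * of_real (\<theta> / 2))) + of_real r * exp (\<i> * of_real (\<theta> / 2)))"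
    by (simp add: Re_exp algebra_simps)
  also have "of_real x * exp (- (\<i> * of_real (\<theta> / 2))) + of_real r * exp (\<i> * of_real (\<theta> / 2))
      = exp (- (\<i> * of_real (\<theta> / 2))) * (of_real x + ray_point r \<theta>)"
    unfolding e[symmetric] ray_point_def by (simp add: algebra_simps)
  also have "Re \<dots> \<le> norm \<dots>" by (rule complex_Re_le_cmod)
  also have "\<dots> = norm (of_real x + ray_point r \<theta>)"
    by (simp add: norm_mult)
  finally show ?thesis .
qed

subsection \<open>The integral over the positive axis\<close>

text \<open>With \<open>w = csqrt z\<close> and \<open>x = exp (sqrt u - T)\<close>, a primitive in
  \<open>u\<close> is \<open>2 w / pi\<close> times \<open>Arctan (x / w)\<close>.\<close>

lemma has_contour_integral_f_fun_segment:
  assumes "r > 0" "\<bar>\<theta>\<bar> < pi" "0 < x0" "x0 \<le> x1"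
  defines "z \<equiv> ray_point r \<theta>"
  shows "((\<lambda>u. f_fun T u z) has_contour_integral
          2 / pi * csqrt z * Arctan (of_real (exp (sqrt x1 - T)) / csqrt z)
        - 2 / pi * csqrt z * Arctan (of_real (exp (sqrt x0 - T)) / csqrt z))
      (linepath (of_real x0) (of_real x1))"
proof -
  define w where "w = csqrt z"
  define F where "F = (\<lambda>u. 2 / of_real pi * w * Arctan (exp (csqrt u - of_real T) / w))"
  have z0: "z \<noteq> 0" using assms(1) by (simp add: z_def ray_point_def)
  then have w0: "w \<noteq> 0" and w2: "w\<^sup>2 = z" by (simp_all add: w_def)
  have Rew: "Re w > 0"
  proof -
    have "cos (\<theta> / 2) > 0" using assms by (intro cos_gt_zero_pi) auto
    then show ?thesis
      using assms(1) unfolding w_def z_def csqrt_ray_point[OF assms(1,2)] by (simp add: Re_exp)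
  qed
  have D: "(F has_field_derivative f_fun T u z) (at u within closed_segment (of_real x0) (of_real x1))"
    if u: "u \<in> closed_segment (of_real x0) (of_real x1)" for u
  proof -
    obtain x where x: "u = of_real x" "x > 0"
      using u assms(3,4) by (auto simp: closed_segment_of_real closed_segment_eq_real_ivl)
    define E where "E = exp (csqrt u - of_real T)"
    have E: "E = of_real (exp (sqrt x - T))"
      unfolding E_def using x by (simp add: csqrt_of_real exp_of_real flip: of_real_diff)
    \<comment> \<open>On the segment \<open>E\<close> is positive and \<open>w\<close> has positive
      real part, so the quotient avoids the cuts of \<open>Arctan\<close>.\<close>
    have "0 < Re (E / w)"
      using Rew unfolding E by (simp add: Re_divide_of_real Re_divide divide_pos_pos sum_power2_gt_zero_iff)
    then have "(Arctan has_field_derivative inverse (1 + (E / w)\<^sup>2)) (at (E / w))"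
      by (intro has_field_derivative_Arctan) auto
    moreover have "u \<notin> \<real>\<^sub>\<le>\<^sub>0" using x by (simp add: complex_nonpos_Reals_iff)
    then have "((\<lambda>u. exp (csqrt u - of_real T) / w) has_field_derivative
        E * (inverse (2 * csqrt u) - 0) / w) (at u)"
      unfolding E_def
      by (intro DERIV_cdivide DERIV_chain2[of exp] DERIV_exp DERIV_diff has_field_derivative_csqrt DERIV_const)
    then have "((\<lambda>u. exp (csqrt u - of_real T) / w) has_field_derivative
        E * inverse (2 * csqrt u) / w) (at u)"
      by simp
    ultimately have d: "(F has_field_derivative
        2 / of_real pi * w * (inverse (1 + (E / w)\<^sup>2) * (E * inverse (2 * csqrt u) / w))) (at u)"
      unfolding F_def by (intro DERIV_cmult DERIV_chain2[of Arctan]) (simp_all add: E_def)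
    have E2: "E\<^sup>2 = exp (2 * (csqrt u - of_real T))"
      unfolding E_def by (rule exp_double[symmetric])
    have "inverse (1 + (E / w)\<^sup>2) = z / (z + E\<^sup>2)"
    proof -
      have "1 + (E / w)\<^sup>2 = (z + E\<^sup>2) / z"
        using z0 w0 by (simp add: power_divide w2 add_divide_distrib)
      then show ?thesis by simp
    qed
    moreover have "2 / P * w * (z / D * (E * inverse (2 * c) / w)) = z / P * (1 / c) * E / D" for P D c
      using w0 by (cases "P = 0"; cases "D = 0"; cases "c = 0"; simp add: field_simps)
    ultimately have "2 / of_real pi * w * (inverse (1 + (E / w)\<^sup>2) * (E * inverse (2 * csqrt u) / w))
       = z / of_real pi * (1 / csqrt u) * E / (E\<^sup>2 + z)"
      by (simp only: add.commute)
    also have "\<dots> = f_fun T u z"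
      unfolding f_fun_def E2[symmetric] E_def[symmetric] ..
    finally show ?thesis using has_field_derivative_at_within[OF d] by (simp only:)
  qed
  have "((\<lambda>u. f_fun T u z) has_contour_integral
      F (pathfinish (linepath (of_real x0) (of_real x1))) - F (pathstart (linepath (of_real x0) (of_real x1))))
      (linepath (of_real x0) (of_real x1))"
    by (rule contour_integral_primitive[OF D]) auto
  moreover have "F (of_real x) = 2 / pi * csqrt z * Arctan (of_real (exp (sqrt x - T)) / csqrt z)"
    if "0 < x" for x
    using that by (simp add: F_def csqrt_of_real w_def exp_of_real flip: of_real_diff)
  ultimately show ?thesis
    using assms(3,4) by (simp only: pathfinish_linepath pathstart_linepath less_le_trans)
qed

text \<open>At the lower end the argument of \<open>Arctan\<close> is treated as small. At the upper
  end \<open>Arctan_inverse\<close> produces \<open>pi / 2\<close>, which yields exactly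
  \<open>w\<close>, and leaves the arctangent of \<open>w / X1\<close>. Both arguments lie in the
  sector with \<open>\<kappa> = cos (\<theta> / 2)\<close>, since \<open>w\<close> has angle
  \<open>\<theta> / 2\<close>.\<close>

lemma norm_Arctan_difference_le:
  fixes w :: complex
  assumes "r > 0" "\<bar>\<theta>\<bar> < pi" "X0 > 0" "X1 > 0"
  defines "w \<equiv> csqrt (ray_point r \<theta>)"
  shows "norm (2 / pi * w * Arctan (of_real X1 / w) - 2 / pi * w * Arctan (of_real X0 / w) - w)
     \<le> (X0 + r / X1) / cos (\<theta> / 2)"
proof -
  define \<kappa> where "\<kappa> = cos (\<theta> / 2)"
  have \<kappa>: "\<kappa> > 0" "\<kappa> \<le> 1" unfolding \<kappa>_def using assms by (auto intro!: cos_gt_zero_pi)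
  have w: "w = of_real (sqrt r) * exp (\<i> * of_real (\<theta> / 2))"
    unfolding w_def using assms by (intro csqrt_ray_point) auto
  have nw: "norm w = sqrt r" using assms(1) by (simp add: w norm_mult)
  have w0: "w \<noteq> 0" using nw assms(1) by auto
  have sec: "\<kappa> * norm w \<le> Re w" unfolding nw by (simp add: \<kappa>_def w Re_exp mult.commute)
  have seci: "\<kappa> * norm (of_real x / w) \<le> Re (of_real x / w)" if "x > 0" for x
  proof -
    have "of_real x / w = of_real (x / sqrt r) * exp (- (\<i> * of_real (\<theta> / 2)))"
      by (simp add: w exp_minus inverse_eq_divide)
    moreover have "\<kappa> * norm (of_real y * exp (- (\<i> * of_real (\<theta> / 2)))) \<le> Re (of_real y * exp (- (\<i> * of_real (\<theta> / 2))))"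
      if "y > 0" for y
      using that by (simp add: norm_mult Re_exp \<kappa>_def)
    moreover have "x / sqrt r > 0" using that assms(1) by simp
    ultimately show ?thesis by (simp only:)
  qed
  have "norm (Arctan (of_real X0 / w)) \<le> norm (of_real X0 / w) / \<kappa>"
    by (rule norm_Arctan_le[OF \<kappa>(1) seci[OF assms(3)] \<kappa>(2)])
  then have "norm w * norm (Arctan (of_real X0 / w)) \<le> norm w * (norm (of_real X0 / w) / \<kappa>)"
    by (rule mult_left_mono) simp
  also have "\<dots> = X0 / \<kappa>" using w0 assms(3) by (simp add: norm_divide)
  finally have 1: "norm (w * Arctan (of_real X0 / w)) \<le> X0 / \<kappa>" by (simp add: norm_mult)
  have "\<kappa> * norm (w / of_real X1) \<le> Re (w / of_real X1)"
    using sec assms(4) by (simp add: norm_divide Re_divide_of_real divide_right_mono)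
  then have "norm (Arctan (w / of_real X1)) \<le> norm (w / of_real X1) / \<kappa>"
    using \<kappa> by (intro norm_Arctan_le) auto
  then have "norm w * norm (Arctan (w / of_real X1)) \<le> norm w * (norm (w / of_real X1) / \<kappa>)"
    by (rule mult_left_mono) simp
  also have "\<dots> = r / X1 / \<kappa>" using assms(1,4) by (simp add: norm_divide nw)
  finally have 2: "norm (w * Arctan (w / of_real X1)) \<le> r / X1 / \<kappa>" by (simp add: norm_mult)
  have pos: "Re (of_real X1 / w) > 0"
    using seci[OF assms(4)] \<kappa>(1) w0 assms(4) by (smt (verit) mult_pos_pos divide_eq_0_iff norm_ge_zero of_real_eq_0_iff zero_less_norm_iff)
  have "Arctan (w / of_real X1) = pi / 2 - Arctan (of_real X1 / w)"
    using Arctan_inverse[OF pos] by simp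
  then have A: "Arctan (of_real X1 / w) = pi / 2 - Arctan (w / of_real X1)" by simp
  have "2 / pi * w * Arctan (of_real X1 / w) - 2 / pi * w * Arctan (of_real X0 / w) - w
      = - ((2 / pi) * (w * Arctan (of_real X0 / w) + w * Arctan (w / of_real X1)))"
    unfolding A by (simp add: field_simps)
  then have "norm (2 / pi * w * Arctan (of_real X1 / w) - 2 / pi * w * Arctan (of_real X0 / w) - w)
      = (2 / pi) * norm (w * Arctan (of_real X0 / w) + w * Arctan (w / of_real X1))"
    by (simp only: norm_minus_cancel norm_mult[of "complex_of_real (2 / pi)"] norm_of_real) simp
  also have "\<dots> \<le> 1 * norm (w * Arctan (of_real X0 / w) + w * Arctan (w / of_real X1))"
    using pi_gt3 by (intro mult_right_mono) auto
  also have "\<dots> \<le> X0 / \<kappa> + r / X1 / \<kappa>"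
    using norm_triangle_mono[OF 1 2] by simp
  finally show ?thesis by (simp add: \<kappa>_def add_divide_distrib)
qed

subsection \<open>Poles and residues of the integrand\<close>

text \<open>The square root of a pole of \<open>f\<close>: \<open>2 (s - T)\<close> is a logarithm
  of \<open>-z\<close>, namely the one with imaginary part \<open>\<theta> + \<epsilon> pi\<close>.
  The values 1 and -1 of \<epsilon> give the pole nearest to the real axis on either side.\<close>

definition sqrt_pole :: "real \<Rightarrow> real \<Rightarrow> real \<Rightarrow> real \<Rightarrow> complex" where
  "sqrt_pole T r \<theta> \<epsilon> = Complex (T + ln r / 2) ((\<theta> + \<epsilon> * pi) / 2)"

lemma exp_sqrt_pole:
  assumes "r > 0" "\<epsilon> \<in> {1, -1}"
  shows "exp (2 * (sqrt_pole T r \<theta> \<epsilon> - of_real T)) = - ray_point r \<theta>"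
proof -
  have "2 * (sqrt_pole T r \<theta> \<epsilon> - of_real T) = Complex (ln r) (\<theta> + \<epsilon> * pi)"
    by (simp add: sqrt_pole_def complex_eq_iff)
  then have "exp (2 * (sqrt_pole T r \<theta> \<epsilon> - of_real T)) = of_real r * cis (\<theta> + \<epsilon> * pi)"
    using assms(1) by (simp add: exp_eq_polar exp_of_real)
  also have "cis (\<theta> + \<epsilon> * pi) = - cis \<theta>"
    using assms(2) by (auto simp: complex_eq_iff cos_diff sin_diff)
  finally show ?thesis by (simp add: ray_point_def cis_conv_exp)
qed

text \<open>With \<open>L = T + ln r / 2\<close>, every zero of the denominator has
  \<open>Im u = L (\<theta> + pi + 2 n pi)\<close> for an integer \<open>n\<close>. The values 0 and
  -1 give the two known poles; all other \<open>n\<close> give modulus at least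
  \<open>L (3 pi - \<bar>\<theta>\<bar>)\<close>. The strict bound on \<open>Im u\<close> also
  forces \<open>L > 0\<close>.\<close>

lemma sqrt_pole_square_unique:
  assumes "r > 0" "\<bar>Im u\<bar> < (T + ln r / 2) * (3 * pi - \<bar>\<theta>\<bar>)" "\<bar>\<theta>\<bar> < pi"
    and "exp (2 * (csqrt u - of_real T)) + ray_point r \<theta> = 0"
  shows "u = (sqrt_pole T r \<theta> 1)\<^sup>2 \<or> u = (sqrt_pole T r \<theta> (-1))\<^sup>2"
proof -
  define L where "L = T + ln r / 2"
  have "exp (2 * (csqrt u - of_real T)) = exp (2 * (sqrt_pole T r \<theta> 1 - of_real T))"
    using exp_sqrt_pole[OF assms(1), of 1 T \<theta>] assms(4) by (metis add_eq_0_iff2 insertI1)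
  then obtain n :: int where
    n: "2 * (csqrt u - of_real T) = 2 * (sqrt_pole T r \<theta> 1 - of_real T) + (of_int (2 * n) * pi) * \<i>"
    unfolding exp_eq by blast
  have c: "csqrt u = Complex L ((\<theta> + pi) / 2 + n * pi)"
    using n by (simp add: complex_eq_iff sqrt_pole_def L_def field_simps)
  have "u = (csqrt u)\<^sup>2" by simp
  also have "\<dots> = (Complex L ((\<theta> + pi) / 2 + n * pi))\<^sup>2" by (simp only: c)
  finally have u: "u = (Complex L ((\<theta> + pi) / 2 + n * pi))\<^sup>2" .
  have Im: "Im u = L * (\<theta> + pi + 2 * n * pi)"
    unfolding u by (simp add: power2_eq_square algebra_simps)
  have "0 \<le> \<bar>Im u\<bar>" by simp
  then have "0 < L * (3 * pi - \<bar>\<theta>\<bar>)" using assms(2) unfolding L_def by linarith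
  then have L: "L > 0" using assms(3) pi_gt_zero by (simp add: zero_less_mult_iff)
  have "\<bar>Im u\<bar> = L * \<bar>\<theta> + pi + 2 * n * pi\<bar>" using L by (simp add: Im abs_mult)
  then have b: "\<bar>\<theta> + pi + 2 * n * pi\<bar> < 3 * pi - \<bar>\<theta>\<bar>"
    using assms(2) L unfolding L_def[symmetric] by simp
  have "n < 1"
  proof (rule ccontr)
    assume "\<not> n < 1"
    then have "1 * pi \<le> n * pi" by (intro mult_right_mono) auto
    then show False using b by linarith
  qed
  moreover have "n > -2"
  proof (rule ccontr)
    assume "\<not> n > -2"
    then have "n * pi \<le> (-2) * pi" by (intro mult_right_mono) auto
    then show False using b by linarith
  qed
  ultimately have "n = 0 \<or> n = -1" by arith
  then show ?thesis
    unfolding u sqrt_pole_def L_def by (auto simp: field_simps)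
qed

lemma f_fun_holomorphic_on:
  assumes "\<And>u. u \<in> A \<Longrightarrow> 0 < Re u" "\<And>u. u \<in> A \<Longrightarrow> exp (2 * (csqrt u - of_real T)) + z \<noteq> 0"
  shows "(\<lambda>u. f_fun T u z) holomorphic_on A"
proof -
  have *: "u \<notin> \<real>\<^sub>\<le>\<^sub>0" "csqrt u \<noteq> 0" if "u \<in> A" for u
    using assms(1)[OF that] by (auto simp: complex_nonpos_Reals_iff)
  show ?thesis
    unfolding f_fun_def using assms(2) *
    by (intro holomorphic_intros)
qed

text \<open>The derivative of the denominator at the pole is \<open>-z / s\<close>, so the factors
  \<open>z\<close> and \<open>1 / csqrt u\<close> of \<open>f\<close> cancel. The factor
  \<open>g\<close> is the constant 1 on the half-rectangles and \<open>m_fun h\<close> on the full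
  one.\<close>

lemma residue_f_fun_mult:
  assumes "open S" "s\<^sup>2 \<in> S" "(\<lambda>u. f_fun T u z * g u) holomorphic_on S - {s\<^sup>2}"
    and "isCont g (s\<^sup>2)" "0 < Re s" "0 < Re (s\<^sup>2)" "exp (2 * (s - of_real T)) = - z" "z \<noteq> 0"
  shows "residue (\<lambda>u. f_fun T u z * g u) (s\<^sup>2) = - (exp (s - of_real T) / pi) * g (s\<^sup>2)"
proof -
  define A where "A = (\<lambda>u. z / of_real pi * (1 / csqrt u) * exp (csqrt u - of_real T) * g u)"
  define B where "B = (\<lambda>u. exp (2 * (csqrt u - of_real T)) + z)"
  have AB: "(\<lambda>u. f_fun T u z * g u) = (\<lambda>u. A u / B u)"
    by (simp add: fun_eq_iff f_fun_def A_def B_def)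
  have s: "csqrt (s\<^sup>2) = s" "s \<noteq> 0" using assms(5) by (auto intro!: csqrt_square)
  have np: "s\<^sup>2 \<notin> \<real>\<^sub>\<le>\<^sub>0" using assms(6) by (simp add: complex_nonpos_Reals_iff)
  have "residue (\<lambda>u. A u / B u) (s\<^sup>2) = A (s\<^sup>2) / (- z / s)"
  proof (rule residue_quotient_simple_zero[OF assms(1,2)])
    show "(\<lambda>u. A u / B u) holomorphic_on S - {s\<^sup>2}" using assms(3) by (simp only: AB)
    show "isCont A (s\<^sup>2)"
      unfolding A_def using np s assms(4) by (intro continuous_intros continuous_at_csqrt) auto
    have "(B has_field_derivative exp (2 * (csqrt (s\<^sup>2) - of_real T)) * (2 * (inverse (2 * csqrt (s\<^sup>2)) - 0)) + 0) (at (s\<^sup>2))"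
      unfolding B_def
      by (intro DERIV_add DERIV_const DERIV_chain2[of exp] DERIV_exp DERIV_cmult DERIV_diff
            has_field_derivative_csqrt np)
    moreover have "exp (2 * (csqrt (s\<^sup>2) - of_real T)) * (2 * (inverse (2 * csqrt (s\<^sup>2)) - 0)) + 0 = - z / s"
      unfolding s(1) assms(7) using s(2) by (simp add: field_simps)
    ultimately show "(B has_field_derivative - z / s) (at (s\<^sup>2))" by (simp only:)
    show "B (s\<^sup>2) = 0" using s assms(7) by (simp add: B_def)
    show "- z / s \<noteq> 0" using s assms(8) by simp
  qed
  also have "\<dots> = - (exp (s - of_real T) / pi) * g (s\<^sup>2)"
    using s assms(8) by (simp add: A_def)
  finally show ?thesis by (simp only: AB)
qed

lemma sin_pi_of_nat_div:
  assumes "h > 0"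
  shows "sin (of_real pi * of_real (real j * h) / of_real h) = (0::complex)"
    "cos (of_real pi * of_real (real j * h) / of_real h) = ((-1) ^ j::complex)"
proof -
  have e: "of_real pi * of_real (real j * h) / of_real h = complex_of_real (real j * pi)"
    using assms by simp
  show "sin (of_real pi * of_real (real j * h) / of_real h) = (0::complex)"
    unfolding e sin_of_real by simp
  show "cos (of_real pi * of_real (real j * h) / of_real h) = ((-1) ^ j::complex)"
    unfolding e cos_of_real by simp
qed

text \<open>The factor \<open>-i / 2\<close> in \<open>m\<close> is chosen so that
  \<open>2 pi i\<close> times this residue is \<open>h g(p)\<close>, one term of the trapezoidal
  sum.\<close>

lemma residue_mult_m_fun:
  assumes "h > 0" "open S" "p \<in> S" "(\<lambda>u. g u * m_fun h u) holomorphic_on S - {p}"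
    and "isCont g p" "p = of_real (real j * h)"
  shows "residue (\<lambda>u. g u * m_fun h u) p = g p * (h / (2 * pi * \<i>))"
proof -
  define A where "A = (\<lambda>u. g u * (- (\<i> / 2)) * cos (of_real pi * u / of_real h))"
  define B where "B = (\<lambda>u::complex. sin (of_real pi * u / of_real h))"
  have AB: "(\<lambda>u. g u * m_fun h u) = (\<lambda>u. A u / B u)"
    by (simp add: fun_eq_iff m_fun_def A_def B_def cot_def)
  have sp: "B p = 0" and cp: "cos (of_real pi * p / of_real h) = (-1) ^ j"
    unfolding B_def assms(6) using sin_pi_of_nat_div[OF assms(1)] by auto
  have "residue (\<lambda>u. A u / B u) p = A p / ((-1) ^ j * (of_real pi / of_real h))"
  proof (rule residue_quotient_simple_zero[OF assms(2,3)])
    show "(\<lambda>u. A u / B u) holomorphic_on S - {p}" using assms(4) by (simp only: AB)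
    show "isCont A p"
      unfolding A_def using assms(1,5) by (intro continuous_intros) auto
    have "(B has_field_derivative cos (of_real pi * p / of_real h) * (of_real pi * 1 / of_real h)) (at p)"
      unfolding B_def
      by (intro DERIV_chain2[of sin] DERIV_sin DERIV_cdivide DERIV_cmult DERIV_ident)
    then show "(B has_field_derivative (-1) ^ j * (of_real pi / of_real h)) (at p)"
      by (simp add: cp)
  qed (use sp assms(1) in auto)
  also have "\<dots> = g p * (h / (2 * pi * \<i>))"
    unfolding A_def cp using assms(1) by (simp add: field_simps)
  finally show ?thesis by (simp only: AB)
qed

lemma m_fun_holomorphic_on:
  assumes "\<And>u. u \<in> A \<Longrightarrow> sin (of_real pi * u / of_real h) \<noteq> 0" "h > 0"
  shows "m_fun h holomorphic_on A"
  unfolding m_fun_def cot_def using assms by (intro holomorphic_intros) auto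

lemma sin_pi_div_eq_0_iff:
  assumes "h > 0"
  shows "sin (of_real pi * u / of_real h) = (0::complex) \<longleftrightarrow> (\<exists>n::int. u = of_real (of_int n * h))"
proof
  assume "sin (of_real pi * u / of_real h) = (0::complex)"
  then obtain n :: int where "of_real pi * u / of_real h = of_real (n * pi)"
    unfolding sin_eq_0 by blast
  then show "\<exists>n::int. u = of_real (of_int n * h)"
    using assms by (intro exI[of _ n]) (simp add: field_simps)
next
  assume "\<exists>n::int. u = of_real (of_int n * h)"
  then obtain n :: int where u: "u = of_real (of_int n * h)" by blast
  have "of_real pi * u / of_real h = complex_of_real (n * pi)"
    using assms by (simp add: u)
  then show "sin (of_real pi * u / of_real h) = (0::complex)"
    unfolding sin_eq_0 by blast
qed

text \<open>\<mu> is the limit of \<open>m\<close> far from the real axis in each half-plane. With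
  \<open>q\<close> the exponential of \<open>\<plusminus> 2 pi i u / h\<close>, the sign making it
  decay, \<delta> equals \<open>q / (1 - q)\<close> up to sign; the second hypothesis keeps
  \<open>1 - q\<close> away from 0.\<close>

lemma norm_delta_fun_le:
  assumes "h > 0" "exp (- (2 * pi * \<bar>Im u\<bar> / h)) \<le> 1 / 2" "Im u \<noteq> 0"
  shows "norm (delta_fun h u) \<le> 2 * exp (- (2 * pi * \<bar>Im u\<bar> / h))"
proof -
  define w where "w = of_real pi * u / of_real h"
  define q where "q = (if Im u > 0 then exp (2 * \<i> * w) else exp (- (2 * \<i> * w)))"
  have nq: "norm q = exp (- (2 * pi * \<bar>Im u\<bar> / h))"
    using assms(3) by (auto simp: q_def w_def norm_exp_eq_Re Im_divide_of_real mult.assoc)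
  have q1: "q \<noteq> 1" using nq assms(2) by auto
  have e0: "exp (\<i> * w) * exp (- (\<i> * w)) = 1" by (simp flip: exp_add)
  have e2: "exp (2 * \<i> * w) = exp (\<i> * w) * exp (\<i> * w)"
    "exp (- (2 * \<i> * w)) = exp (- (\<i> * w)) * exp (- (\<i> * w))"
    by (simp_all flip: exp_add add: algebra_simps)
  define E E' where "E = exp (\<i> * w)" and "E' = exp (- (\<i> * w))"
  have EE: "E * E' = 1" "E' * E = 1" using e0 by (simp_all add: E_def E'_def mult.commute)
  have cot: "cot w = \<i> * ((E + E') / (E - E'))"
    unfolding cot_def sin_exp_eq cos_exp_eq E_def E'_def by (simp add: divide_simps)
  have n0: "E - E' \<noteq> 0"
  proof
    assume "E - E' = 0"
    then have "E = E'" by simp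
    then have "q = 1" using EE e2 by (simp add: q_def E_def E'_def)
    then show False using q1 by simp
  qed
  have m: "m_fun h u = (E + E') / (E - E') / 2"
  proof -
    have "- (\<i> / 2) * (\<i> * Q) = Q / 2" for Q
      by (simp add: field_simps)
    then show ?thesis unfolding m_fun_def w_def[symmetric] cot by blast
  qed
  have half: "- 1 / 2 - (E + E') / (E - E') / 2 = - (E / (E - E'))"
    "1 / 2 - (E + E') / (E - E') / 2 = - (E' / (E - E'))"
  proof -
    have "(E + E') / (E - E') / 2 = E / (E - E') - 1 / 2" "(E + E') / (E - E') / 2 = E' / (E - E') + 1 / 2"
      using n0 by (auto simp: divide_simps)
    then show "- 1 / 2 - (E + E') / (E - E') / 2 = - (E / (E - E'))"
      "1 / 2 - (E + E') / (E - E') / 2 = - (E' / (E - E'))" by simp_all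
  qed
  have "norm (delta_fun h u) = norm (q / (1 - q))"
  proof (cases "Im u > 0")
    case True
    then have mu: "mu_fun u = - 1 / 2" by (simp add: mu_fun_def)
    have "delta_fun h u = - (E / (E - E'))"
      unfolding delta_fun_def mu m by (rule half(1))
    also have "\<dots> = - (E * E / ((E - E') * E))"
      using EE by auto
    also have "\<dots> = q / (1 - q)"
      using True EE unfolding q_def e2 E_def[symmetric] left_diff_distrib
      by (simp add: minus_divide_right)
    finally show ?thesis by simp
  next
    case False
    then have mu: "mu_fun u = 1 / 2" using assms(3) by (simp add: mu_fun_def)
    have "delta_fun h u = - (E' / (E - E'))"
      unfolding delta_fun_def mu m by (rule half(2))
    also have "\<dots> = - (E' * E' / ((E - E') * E'))"
      using EE by auto
    also have "\<dots> = - (q / (1 - q))"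
      using False EE unfolding q_def e2 E'_def[symmetric] left_diff_distrib by simp
    finally show ?thesis by simp
  qed
  also have "\<dots> = norm q / norm (1 - q)" by (rule norm_divide)
  also have "\<dots> \<le> norm q / (1 / 2)"
  proof (rule divide_left_mono)
    have "1 \<le> norm (1 - q) + norm q" using norm_triangle_ineq[of "1 - q" q] by simp
    then show "1 / 2 \<le> norm (1 - q)" using nq assms(2) by simp
  qed (use q1 in auto)
  finally show ?thesis by (simp add: nq)
qed

subsection \<open>The contour integral of the quadrature error\<close>

lemma has_contour_integral_rectpathD:
  assumes "(f has_contour_integral I) (rectpath (Complex x0 y0) (Complex x1 y1))"
  obtains i1 i2 i3 i4 where
    "(f has_contour_integral i1) (linepath (Complex x0 y0) (Complex x1 y0))"
    "(f has_contour_integral i2) (linepath (Complex x1 y0) (Complex x1 y1))"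
    "(f has_contour_integral i3) (linepath (Complex x1 y1) (Complex x0 y1))"
    "(f has_contour_integral i4) (linepath (Complex x0 y1) (Complex x0 y0))"
    "I = i1 + (i2 + (i3 + i4))"
proof -
  let ?l1 = "linepath (Complex x0 y0) (Complex x1 y0)" and ?l2 = "linepath (Complex x1 y0) (Complex x1 y1)"
  let ?l3 = "linepath (Complex x1 y1) (Complex x0 y1)" and ?l4 = "linepath (Complex x0 y1) (Complex x0 y0)"
  have eq: "rectpath (Complex x0 y0) (Complex x1 y1) = ?l1 +++ ?l2 +++ ?l3 +++ ?l4"
    by (simp add: rectpath_def Let_def)
  have v: "valid_path ?l1" "valid_path ?l2" "valid_path ?l3" "valid_path ?l4"
    "valid_path (?l3 +++ ?l4)" "valid_path (?l2 +++ ?l3 +++ ?l4)"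
    by (auto intro!: valid_path_join)
  have "f contour_integrable_on (?l1 +++ ?l2 +++ ?l3 +++ ?l4)"
    using assms unfolding eq contour_integrable_on_def by blast
  then have "f contour_integrable_on ?l1" "f contour_integrable_on ?l2"
    "f contour_integrable_on ?l3" "f contour_integrable_on ?l4"
    using v by simp_all
  then obtain i1 i2 i3 i4 where i: "(f has_contour_integral i1) ?l1" "(f has_contour_integral i2) ?l2"
    "(f has_contour_integral i3) ?l3" "(f has_contour_integral i4) ?l4"
    unfolding contour_integrable_on_def by blast
  have "(f has_contour_integral (i1 + (i2 + (i3 + i4)))) (?l1 +++ ?l2 +++ ?l3 +++ ?l4)"
    by (intro has_contour_integral_join i v)
  then have "I = i1 + (i2 + (i3 + i4))"
    using assms unfolding eq by (rule has_contour_integral_unique[symmetric])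
  then show thesis using that i by blast
qed

text \<open>Constancy is asked only inside the segment because the vertical sides of the lower
  half-rectangle end on the real axis, where \<mu> already has its upper value.\<close>

lemma has_contour_integral_linepath_mult_const:
  assumes "(f has_contour_integral i) (linepath p q)"
    and "\<And>t. 0 < t \<Longrightarrow> t < 1 \<Longrightarrow> g (linepath p q t) = c"
  shows "((\<lambda>u. f u * g u) has_contour_integral (i * c)) (linepath p q)"
proof -
  have "((\<lambda>x. f (linepath p q x) * (q - p) * c) has_integral (i * c)) {0..1}"
    using assms(1) unfolding has_contour_integral_linepath by (rule has_integral_mult_left)
  then have "((\<lambda>x. f (linepath p q x) * g (linepath p q x) * (q - p)) has_integral (i * c)) {0..1}"
    by (rule has_integral_spike_finite[of "{0, 1}", rotated 2]) (auto simp: assms(2))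
  then show ?thesis unfolding has_contour_integral_linepath .
qed

text \<open>The outer sides of the upper half contribute \<open>Iu - J\<close> and those of the
  lower half \<open>Il + J\<close>, since the real segment is traversed in opposite directions.
  Weighted by -1/2 and 1/2 they give \<open>J\<close> once, plus
  \<open>(Il - Iu) / 2\<close>.\<close>

lemma has_contour_integral_mult_mu_fun:
  assumes "a > 0"
    and "(f has_contour_integral Iu) (rectpath (Complex x0 0) (Complex x1 a))"
    and "(f has_contour_integral Il) (rectpath (Complex x0 (-a)) (Complex x1 0))"
    and "(f has_contour_integral J) (linepath (of_real x0) (of_real x1))"
  shows "((\<lambda>u. f u * mu_fun u) has_contour_integral (J + (Il - Iu) / 2)) (rect_boundary x0 x1 a)"
proof -
  have J: "(f has_contour_integral J) (linepath (Complex x0 0) (Complex x1 0))"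
    using assms(4) by (simp add: complex_of_real_def)
  obtain u1 u2 u3 u4 where u:
    "(f has_contour_integral u1) (linepath (Complex x0 0) (Complex x1 0))"
    "(f has_contour_integral u2) (linepath (Complex x1 0) (Complex x1 a))"
    "(f has_contour_integral u3) (linepath (Complex x1 a) (Complex x0 a))"
    "(f has_contour_integral u4) (linepath (Complex x0 a) (Complex x0 0))"
    "Iu = u1 + (u2 + (u3 + u4))"
    by (rule has_contour_integral_rectpathD[OF assms(2)])
  obtain l1 l2 l3 l4 where l:
    "(f has_contour_integral l1) (linepath (Complex x0 (-a)) (Complex x1 (-a)))"
    "(f has_contour_integral l2) (linepath (Complex x1 (-a)) (Complex x1 0))"
    "(f has_contour_integral l3) (linepath (Complex x1 0) (Complex x0 0))"
    "(f has_contour_integral l4) (linepath (Complex x0 0) (Complex x0 (-a)))"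
    "Il = l1 + (l2 + (l3 + l4))"
    by (rule has_contour_integral_rectpathD[OF assms(3)])
  have uJ: "u1 = J" by (rule has_contour_integral_unique[OF u(1) J])
  have lJ: "l3 = - J"
    by (rule has_contour_integral_unique[OF l(3) has_contour_integral_reverse_linepath[OF J]])
  have Im: "Im (linepath (Complex p y) (Complex q y') t) = (1 - t) * y + t * y'" for p q y y' t
    by (simp add: linepath_def)
  let ?g = "\<lambda>u. f u * mu_fun u"
  have up: "(?g has_contour_integral (i * (- 1 / 2))) (linepath (Complex p y) (Complex q y'))"
    if "(f has_contour_integral i) (linepath (Complex p y) (Complex q y'))" "y \<ge> 0" "y' \<ge> 0" for i p q y y'
    by (rule has_contour_integral_linepath_mult_const[OF that(1)]) (use that(2,3) in \<open>simp add: mu_fun_def Im\<close>)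
  have dn: "(?g has_contour_integral (i * (1 / 2))) (linepath (Complex p y) (Complex q y'))"
    if "(f has_contour_integral i) (linepath (Complex p y) (Complex q y'))" "y \<le> 0" "y' \<le> 0" "y < 0 \<or> y' < 0" for i p q y y'
  proof (rule has_contour_integral_linepath_mult_const[OF that(1)])
    fix t :: real assume t: "0 < t" "t < 1"
    have "(1 - t) * y + t * y' < 0"
      using t that(2-4) by (metis add_neg_nonpos add_nonpos_neg diff_gt_0_iff_gt less_imp_le mult_nonneg_nonpos mult_pos_neg)
    then show "mu_fun (linepath (Complex p y) (Complex q y') t) = 1 / 2"
      by (simp add: mu_fun_def Im not_le)
  qed
  have 1: "(?g has_contour_integral (l1 * (1 / 2))) (linepath (Complex x0 (-a)) (Complex x1 (-a)))"
    by (rule dn[OF l(1)]) (use assms(1) in auto)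
  \<comment> \<open>The vertical sides are cut at their midpoints, which lie on the real axis where
    \<mu> jumps.\<close>
  have 2: "(?g has_contour_integral (l2 * (1 / 2) + u2 * (- 1 / 2))) (linepath (Complex x1 (-a)) (Complex x1 a))"
    by (rule has_contour_integral_split[of _ _ _ "Complex x1 0" _ _ "1 / 2", OF dn[OF l(2)] up[OF u(2)]])
       (use assms(1) in \<open>auto simp: complex_eq_iff\<close>)
  have 3: "(?g has_contour_integral (u3 * (- 1 / 2))) (linepath (Complex x1 a) (Complex x0 a))"
    by (rule up[OF u(3)]) (use assms(1) in auto)
  have 4: "(?g has_contour_integral (u4 * (- 1 / 2) + l4 * (1 / 2))) (linepath (Complex x0 a) (Complex x0 (-a)))"
    by (rule has_contour_integral_split[of _ _ _ "Complex x0 0" _ _ "1 / 2", OF up[OF u(4)] dn[OF l(4)]])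
       (use assms(1) in \<open>auto simp: complex_eq_iff\<close>)
  have "(?g has_contour_integral (l1 * (1 / 2) + ((l2 * (1 / 2) + u2 * (- 1 / 2)) + (u3 * (- 1 / 2) + (u4 * (- 1 / 2) + l4 * (1 / 2)))))) (rect_boundary x0 x1 a)"
    unfolding rect_boundary_def
    by (intro has_contour_integral_join 1 2 3 4 valid_path_join valid_path_linepath) simp_all
  moreover have "l1 * (1 / 2) + ((l2 * (1 / 2) + u2 * (- 1 / 2)) + (u3 * (- 1 / 2) + (u4 * (- 1 / 2) + l4 * (1 / 2))))
     = J + (Il - Iu) / 2"
    unfolding u(5) l(5) uJ lJ by (simp add: field_simps)
  ultimately show ?thesis by simp
qed

lemma rect_boundary_eq_rectpath: "rect_boundary x0 x1 a = rectpath (Complex x0 (-a)) (Complex x1 a)"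
  by (simp add: rect_boundary_def rectpath_def Let_def)

text \<open>The half-rectangle integrals of \<open>f\<close> enter with weights -1/2 and 1/2, which
  are the values of \<mu> at the two poles. Subtracting the residues of \<open>f m\<close> at the
  same poles turns these weights into values of \<delta>; the residues of \<open>m\<close> at the
  nodes give the sum.\<close>

lemma contour_integral_delta_fun:
  fixes r \<theta> T h x0 x1 a :: real and M :: nat
  defines "z \<equiv> ray_point r \<theta>" and "L \<equiv> T + ln r / 2"
  defines "sp \<equiv> sqrt_pole T r \<theta> 1" and "sm \<equiv> sqrt_pole T r \<theta> (-1)"
  assumes "r > 0" "\<bar>\<theta>\<bar> < pi" "h > 0" "L > 0"
    and x: "0 < x0" "x0 < h" "x1 = M * h + x0"
    and a: "L * (pi + \<bar>\<theta>\<bar>) < a" "a < L * (3 * pi - \<bar>\<theta>\<bar>)"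
    and in_sp: "x0 < Re (sp\<^sup>2)" "Re (sp\<^sup>2) < x1" and in_sm: "x0 < Re (sm\<^sup>2)" "Re (sm\<^sup>2) < x1"
    and J: "((\<lambda>u. f_fun T u z) has_contour_integral J) (linepath (of_real x0) (of_real x1))"
  shows "((\<lambda>u. f_fun T u z * delta_fun h u) has_contour_integral
      (J - h * (\<Sum>j=1..M. f_fun T (of_real (j * h)) z)
        - 2 * \<i> * (exp (sp - of_real T) * delta_fun h (sp\<^sup>2) + exp (sm - of_real T) * delta_fun h (sm\<^sup>2))))
      (rect_boundary x0 x1 a)"
proof -
  let ?f = "\<lambda>u. f_fun T u z"
  \<comment> \<open>No further pole of \<open>f\<close> lies below height \<open>b\<close>, the two
    known poles have distance at least \<open>c\<close> from the real axis, and \<open>x2\<close> is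
    the first node beyond the rectangle. The open boxes below enclose the closed rectangles;
    starting at real part 0, they miss the cut of \<open>csqrt\<close> and the node 0, and the bound
    \<open>c\<close> keeps the opposite pole out of each half.\<close>
  define b where "b = L * (3 * pi - \<bar>\<theta>\<bar>)"
  define c where "c = L * (pi - \<bar>\<theta>\<bar>)"
  define x2 where "x2 = (M + 1) * h"
  have z0: "z \<noteq> 0" using assms(5) by (simp add: z_def ray_point_def)
  have c0: "c > 0" using assms by (simp add: c_def)
  have cb: "c < a" using a(1) \<open>L > 0\<close> unfolding c_def
    by (smt (verit) mult_left_mono)
  have ab: "a < b" using a by (simp add: b_def)
  have x12: "0 < x0" "x0 < x1" "x1 < x2"
    using x in_sp by (auto simp: x2_def algebra_simps)
  have Im_sp: "Im (sp\<^sup>2) = L * (\<theta> + pi)" and Im_sm: "Im (sm\<^sup>2) = L * (\<theta> - pi)"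
    by (simp_all add: sp_def sm_def sqrt_pole_def power2_eq_square algebra_simps flip: L_def)
  have Isp: "c \<le> Im (sp\<^sup>2)" "Im (sp\<^sup>2) < a"
  proof -
    show "c \<le> Im (sp\<^sup>2)" unfolding Im_sp c_def using \<open>L > 0\<close> by (intro mult_left_mono) auto
    have "L * (\<theta> + pi) \<le> L * (pi + \<bar>\<theta>\<bar>)" using \<open>L > 0\<close> by (intro mult_left_mono) auto
    then show "Im (sp\<^sup>2) < a" using a(1) Im_sp by linarith
  qed
  have Ism: "Im (sm\<^sup>2) \<le> - c" "- a < Im (sm\<^sup>2)"
  proof -
    have "c \<le> L * (pi - \<theta>)" unfolding c_def using \<open>L > 0\<close> by (intro mult_left_mono) auto
    then show "Im (sm\<^sup>2) \<le> - c" unfolding Im_sm by (simp add: algebra_simps)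
    have "L * (pi - \<theta>) \<le> L * (pi + \<bar>\<theta>\<bar>)" using \<open>L > 0\<close> by (intro mult_left_mono) auto
    then show "- a < Im (sm\<^sup>2)" using a(1) unfolding Im_sm by (simp add: algebra_simps)
  qed
  have Res: "0 < Re sp" "0 < Re sm" using \<open>L > 0\<close> by (simp_all add: sp_def sm_def sqrt_pole_def L_def)
  have Res2: "0 < Re (sp\<^sup>2)" "0 < Re (sm\<^sup>2)" using in_sp in_sm x(1) by linarith+
  have exps: "exp (2 * (sp - of_real T)) = - z" "exp (2 * (sm - of_real T)) = - z"
    unfolding sp_def sm_def z_def using assms(5) by (simp_all only: exp_sqrt_pole insert_iff simp_thms)
  have zeros: "u = sp\<^sup>2 \<or> u = sm\<^sup>2" if "\<bar>Im u\<bar> < b" "exp (2 * (csqrt u - of_real T)) + z = 0" for u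
    unfolding sp_def sm_def using that assms(5,6) unfolding b_def L_def z_def
    by (intro sqrt_pole_square_unique) auto
  define Su where "Su = box (Complex 0 (-c)) (Complex x2 b)"
  define Sl where "Sl = box (Complex 0 (-b)) (Complex x2 c)"
  define S where "S = box (Complex 0 (-b)) (Complex x2 b)"
  have op: "open Su" "open Sl" "open S" "connected Su" "connected Sl" "connected S"
    by (auto simp: Su_def Sl_def S_def convex_connected)
  have holu: "?f holomorphic_on Su - {sp\<^sup>2}"
  proof (rule f_fun_holomorphic_on)
    fix u assume "u \<in> Su - {sp\<^sup>2}"
    then have u: "0 < Re u" "- c < Im u" "Im u < b" "u \<noteq> sp\<^sup>2" by (auto simp: Su_def in_box_complex_iff)
    show "0 < Re u" by (fact u)
    have "u \<noteq> sm\<^sup>2" using u Ism by auto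
    moreover have "\<bar>Im u\<bar> < b" using u cb ab by auto
    ultimately show "exp (2 * (csqrt u - of_real T)) + z \<noteq> 0" using zeros u(4) by blast
  qed
  have holl: "?f holomorphic_on Sl - {sm\<^sup>2}"
  proof (rule f_fun_holomorphic_on)
    fix u assume "u \<in> Sl - {sm\<^sup>2}"
    then have u: "0 < Re u" "- b < Im u" "Im u < c" "u \<noteq> sm\<^sup>2" by (auto simp: Sl_def in_box_complex_iff)
    show "0 < Re u" by (fact u)
    have "u \<noteq> sp\<^sup>2" using u Isp by auto
    moreover have "\<bar>Im u\<bar> < b" using u cb ab by auto
    ultimately show "exp (2 * (csqrt u - of_real T)) + z \<noteq> 0" using zeros u(4) by blast
  qed
  have hol: "?f holomorphic_on S - {sp\<^sup>2, sm\<^sup>2}"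
  proof (rule f_fun_holomorphic_on)
    fix u assume "u \<in> S - {sp\<^sup>2, sm\<^sup>2}"
    then have u: "0 < Re u" "\<bar>Im u\<bar> < b" "u \<noteq> sp\<^sup>2" "u \<noteq> sm\<^sup>2"
      by (auto simp: S_def in_box_complex_iff abs_less_iff)
    show "0 < Re u" by (fact u)
    show "exp (2 * (csqrt u - of_real T)) + z \<noteq> 0" using zeros u by blast
  qed
  have spS: "sp\<^sup>2 \<in> Su" "sp\<^sup>2 \<in> S" and smS: "sm\<^sup>2 \<in> Sl" "sm\<^sup>2 \<in> S"
    using Isp Ism in_sp in_sm x12 c0 cb ab by (auto simp: Su_def Sl_def S_def in_box_complex_iff)
  have Rf: "residue ?f (s\<^sup>2) = - (exp (s - of_real T) / pi)"
    if "open A" "s\<^sup>2 \<in> A" "?f holomorphic_on A - {s\<^sup>2}" "0 < Re s" "0 < Re (s\<^sup>2)" "exp (2 * (s - of_real T)) = - z" for A s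
    using residue_f_fun_mult[of A s T z "\<lambda>_. 1"] that z0 by simp
  have "(?f has_contour_integral (2 * pi * \<i> * (\<Sum>p\<in>{sp\<^sup>2}. residue ?f p))) (rectpath (Complex x0 0) (Complex x1 a))"
    by (rule has_contour_integral_rectpath_residues[OF op(1,4) _ _ _ _ _ holu])
      (use x12 c0 cb ab Isp in_sp in \<open>auto simp: Su_def in_box_complex_iff in_cbox_complex_iff\<close>)
  moreover have "2 * pi * \<i> * (\<Sum>p\<in>{sp\<^sup>2}. residue ?f p) = - 2 * \<i> * exp (sp - of_real T)"
    using Rf[OF op(1) spS(1) holu Res(1) Res2(1) exps(1)] by simp
  ultimately have U: "(?f has_contour_integral (- 2 * \<i> * exp (sp - of_real T))) (rectpath (Complex x0 0) (Complex x1 a))"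
    by (simp only:)
  have "(?f has_contour_integral (2 * pi * \<i> * (\<Sum>p\<in>{sm\<^sup>2}. residue ?f p))) (rectpath (Complex x0 (-a)) (Complex x1 0))"
    by (rule has_contour_integral_rectpath_residues[OF op(2,5) _ _ _ _ _ holl])
      (use x12 c0 cb ab Ism in_sm in \<open>auto simp: Sl_def in_box_complex_iff in_cbox_complex_iff\<close>)
  moreover have "2 * pi * \<i> * (\<Sum>p\<in>{sm\<^sup>2}. residue ?f p) = - 2 * \<i> * exp (sm - of_real T)"
    using Rf[OF op(2) smS(1) holl Res(2) Res2(2) exps(2)] by simp
  ultimately have D: "(?f has_contour_integral (- 2 * \<i> * exp (sm - of_real T))) (rectpath (Complex x0 (-a)) (Complex x1 0))"
    by (simp only:)
  have a0: "a > 0" using c0 cb by simp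
  note MU = has_contour_integral_mult_mu_fun[OF a0 U D J]

  let ?F = "\<lambda>u. f_fun T u z * m_fun h u"
  define pt where "pt = (\<lambda>j::nat. complex_of_real (real j * h))"
  define P where "P = pt ` {1..M}"
  define pts where "pts = insert (sp\<^sup>2) (insert (sm\<^sup>2) P)"
  have PS: "0 < Re p" "Re p < x1" "x0 < Re p" "Im p = 0" "p \<in> S" if "p \<in> P" for p
  proof -
    obtain j where j: "p = pt j" "1 \<le> j" "j \<le> M" using \<open>p \<in> P\<close> by (auto simp: P_def)
    have "1 * h \<le> j * h" "j * h \<le> M * h" using j \<open>h > 0\<close> by (intro mult_right_mono; simp)+
    moreover have "Re p = j * h" "Im p = 0" by (simp_all add: j pt_def)
    ultimately show "0 < Re p" "Re p < x1" "x0 < Re p" "Im p = 0"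
      using x \<open>h > 0\<close> by linarith+
    then show "p \<in> S" using x12 c0 cb ab by (auto simp: S_def in_box_complex_iff)
  qed
  have fin: "finite pts" by (simp add: pts_def P_def)
  have sin0: "sin (of_real pi * u / of_real h) \<noteq> 0" if "u \<in> S - P" for u
  proof
    assume "sin (of_real pi * u / of_real h) = 0"
    then obtain n :: int where n: "u = of_real (of_int n * h)"
      unfolding sin_pi_div_eq_0_iff[OF \<open>h > 0\<close>] by blast
    have "0 < n * h" "n * h < (M + 1) * h"
      using that unfolding n by (auto simp: S_def in_box_complex_iff x2_def)
    then have "0 < n" "real_of_int n < real (M + 1)"
      using \<open>h > 0\<close> by (auto simp: zero_less_mult_iff)
    then have "0 < n" "n < int M + 1" by linarith+
    then have "u = pt (nat n)" "nat n \<in> {1..M}" by (auto simp: n pt_def)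
    then show False using that by (auto simp: P_def)
  qed
  have holm: "m_fun h holomorphic_on S - P"
    by (rule m_fun_holomorphic_on[OF sin0 \<open>h > 0\<close>])
  have holF: "?F holomorphic_on S - pts"
    by (intro holomorphic_on_mult holomorphic_on_subset[OF hol] holomorphic_on_subset[OF holm])
       (auto simp: pts_def)
  \<comment> \<open>The nodes are real and the poles of \<open>f\<close> are not, so the
    singularities of the two factors never coincide.\<close>
  have nP: "sp\<^sup>2 \<notin> P" "sm\<^sup>2 \<notin> P" "sp\<^sup>2 \<noteq> sm\<^sup>2"
    using PS(4) Isp Ism c0 by force+
  have opp: "open (S - (pts - {p}))" for p
    using op(3) fin by (intro open_Diff finite_imp_closed) auto
  have holFp: "?F holomorphic_on S - (pts - {p}) - {p}" for p
    by (rule holomorphic_on_subset[OF holF]) auto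
  have contm: "isCont (m_fun h) p" if "p \<in> S" "p \<notin> P" for p
  proof -
    have "open (S - P)" using op(3) by (intro open_Diff finite_imp_closed) (auto simp: P_def)
    then show ?thesis
      using holomorphic_on_imp_continuous_on[OF holm] that by (simp add: continuous_on_eq_continuous_at)
  qed
  have contf: "isCont ?f p" if "p \<in> P" for p
  proof -
    have "open (S - {sp\<^sup>2, sm\<^sup>2})" using op(3) by (intro open_Diff finite_imp_closed) auto
    moreover have "p \<in> S - {sp\<^sup>2, sm\<^sup>2}" using that PS(5) nP by auto
    ultimately show ?thesis
      using holomorphic_on_imp_continuous_on[OF hol] by (simp only: continuous_on_eq_continuous_at)
  qed
  have R1: "residue ?F (sp\<^sup>2) = - (exp (sp - of_real T) / pi) * m_fun h (sp\<^sup>2)"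
    by (rule residue_f_fun_mult[OF opp[of "sp\<^sup>2"] _ holFp contm[OF spS(2) nP(1)] Res(1) Res2(1) exps(1) z0])
       (use spS(2) in simp)
  have R2: "residue ?F (sm\<^sup>2) = - (exp (sm - of_real T) / pi) * m_fun h (sm\<^sup>2)"
    by (rule residue_f_fun_mult[OF opp[of "sm\<^sup>2"] _ holFp contm[OF smS(2) nP(2)] Res(2) Res2(2) exps(2) z0])
       (use smS(2) in simp)
  have R3: "residue ?F p = ?f p * (h / (2 * pi * \<i>))" if p: "p \<in> P" for p
  proof -
    obtain j where j: "p = of_real (real j * h)" using p by (auto simp: P_def pt_def)
    show ?thesis
      by (rule residue_mult_m_fun[OF \<open>h > 0\<close> opp[of p] _ holFp contf[OF p] j]) (use PS(5)[OF p] in simp)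
  qed
  have MF: "(?F has_contour_integral (2 * pi * \<i> * (\<Sum>p\<in>pts. residue ?F p))) (rect_boundary x0 x1 a)"
    unfolding rect_boundary_eq_rectpath
  proof (rule has_contour_integral_rectpath_residues[OF op(3,6) _ _ _ fin _ holF])
    show "pts \<subseteq> box (Complex x0 (-a)) (Complex x1 a)"
      using PS Isp Ism in_sp in_sm c0 cb by (auto simp: pts_def in_box_complex_iff)
  qed (use x12 c0 cb ab in \<open>auto simp: S_def in_box_complex_iff in_cbox_complex_iff\<close>)
  have injpt: "inj_on pt {1..M}" using \<open>h > 0\<close> by (auto simp: inj_on_def pt_def)
  have "(\<Sum>p\<in>P. residue ?F p) = (\<Sum>p\<in>P. ?f p * (h / (2 * pi * \<i>)))"
    by (intro sum.cong refl R3)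
  also have "\<dots> = (\<Sum>j=1..M. ?f (pt j)) * (h / (2 * pi * \<i>))"
    unfolding P_def by (subst sum.reindex[OF injpt]) (simp add: sum_distrib_right sum_divide_distrib)
  finally have sumP: "(\<Sum>p\<in>P. residue ?F p) = (\<Sum>j=1..M. ?f (pt j)) * (h / (2 * pi * \<i>))" .
  have "(\<Sum>p\<in>pts. residue ?F p) = residue ?F (sp\<^sup>2) + (residue ?F (sm\<^sup>2) + (\<Sum>p\<in>P. residue ?F p))"
    using nP unfolding pts_def by (subst sum.insert sum.insert; simp add: P_def)+
  moreover have "2 * of_real pi * \<i> * (- (A / of_real pi) * m1 + (- (B / of_real pi) * m2 + s * (h / (2 * pi * \<i>))))
      = - 2 * \<i> * (A * m1 + B * m2) + h * s" for A B m1 m2 s :: complex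
    by (simp add: field_simps)
  ultimately have sumpts: "2 * pi * \<i> * (\<Sum>p\<in>pts. residue ?F p)
      = - 2 * \<i> * (exp (sp - of_real T) * m_fun h (sp\<^sup>2) + exp (sm - of_real T) * m_fun h (sm\<^sup>2))
        + h * (\<Sum>j=1..M. ?f (pt j))"
    unfolding sumP R1 R2 by (simp only: of_real_mult of_real_numeral)
  have mu: "mu_fun (sp\<^sup>2) = - 1 / 2" "mu_fun (sm\<^sup>2) = 1 / 2"
    unfolding mu_fun_def using Isp Ism c0 by auto
  have "(\<lambda>u. ?f u * delta_fun h u) = (\<lambda>u. ?f u * mu_fun u - ?F u)"
    by (simp add: fun_eq_iff delta_fun_def algebra_simps)
  moreover have "J + ((- 2 * \<i> * exp (sm - of_real T)) - (- 2 * \<i> * exp (sp - of_real T))) / 2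
       - (2 * pi * \<i> * (\<Sum>p\<in>pts. residue ?F p))
     = J - h * (\<Sum>j=1..M. f_fun T (of_real (j * h)) z)
        - 2 * \<i> * (exp (sp - of_real T) * delta_fun h (sp\<^sup>2) + exp (sm - of_real T) * delta_fun h (sm\<^sup>2))"
    unfolding sumpts delta_fun_def mu pt_def by (simp add: field_simps)
  ultimately show ?thesis
    using has_contour_integral_diff[OF MU MF] by (simp only:)
qed

subsection \<open>Error of the trapezoidal sum\<close>

lemma hpar_pos: "\<beta> < 2 \<Longrightarrow> hpar \<beta> > 0"
  by (simp add: hpar_def)

lemma Tpar_square: "\<beta> < 2 \<Longrightarrow> 4 * (Tpar \<beta> Nt)\<^sup>2 = Nt * hpar \<beta>"
  using hpar_pos[of \<beta>] by (simp add: Tpar_def)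

lemma Tpar_nonneg: "\<beta> < 2 \<Longrightarrow> 0 \<le> Tpar \<beta> Nt"
  using hpar_pos[of \<beta>] by (simp add: Tpar_def)

lemma half_turn_fraction_less_pi:
  assumes "\<beta> < 2" "\<bar>\<theta>\<bar> = \<beta> * pi / 2"
  shows "\<bar>\<theta>\<bar> < pi"
proof -
  have "\<beta> * pi < 2 * pi" using assms(1) by simp
  then show ?thesis using assms(2) by linarith
qed

lemma cos_half_angle:
  assumes "\<beta> < 2" "\<bar>\<theta>\<bar> = \<beta> * pi / 2"
  shows "cos (\<theta> / 2) = cos (\<beta> * pi / 4)" "0 < cos (\<theta> / 2)"
proof -
  have "\<bar>\<theta> / 2\<bar> = \<beta> * pi / 4" using assms(2) by (simp add: abs_divide)
  then show "cos (\<theta> / 2) = cos (\<beta> * pi / 4)" by (metis cos_abs_real)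
  show "0 < cos (\<theta> / 2)"
    using half_turn_fraction_less_pi[OF assms] by (intro cos_gt_zero_pi) linarith+
qed

lemma pi_square_less: "pi\<^sup>2 < 12"
proof -
  have "pi < 3.2" using pi_approx by simp
  then have "pi * pi < 3.2 * 3.2" using pi_gt_zero by (intro mult_strict_mono) auto
  then show ?thesis by (simp add: power2_eq_square)
qed

text \<open>The lower end of the admitted range of \<open>r\<close> keeps the two poles of \<open>f\<close> nearest to the real
  axis to the right of the left edge of \<open>\<Gamma>\<close>.\<close>
lemma Re_sqrt_pole_square_bounds:
  assumes "0 \<le> \<beta>" "\<bar>\<theta>\<bar> = \<beta> * pi / 2" "2 + \<beta> \<le> T + ln r / 2" "r \<le> 1" "r > 0" "\<epsilon> \<in> {1, -1}"
  shows "1 - \<beta> / 2 < Re ((sqrt_pole T r \<theta> \<epsilon>)\<^sup>2)" "Re ((sqrt_pole T r \<theta> \<epsilon>)\<^sup>2) \<le> T\<^sup>2"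
proof -
  define L where "L = T + ln r / 2"
  have Re: "Re ((sqrt_pole T r \<theta> \<epsilon>)\<^sup>2) = L\<^sup>2 - (\<theta> + \<epsilon> * pi)\<^sup>2 / 4"
    by (simp add: sqrt_pole_def L_def power2_eq_square field_simps)
  have "\<bar>\<theta> + \<epsilon> * pi\<bar> \<le> pi * (1 + \<beta> / 2)"
  proof -
    have ep: "\<bar>\<epsilon> * pi\<bar> = pi" using assms(6) by auto
    have "\<bar>\<theta> + \<epsilon> * pi\<bar> \<le> \<bar>\<theta>\<bar> + pi" using ep by linarith
    then show ?thesis using assms(2) by (simp add: algebra_simps)
  qed
  then have "\<bar>\<theta> + \<epsilon> * pi\<bar>\<^sup>2 \<le> (pi * (1 + \<beta> / 2))\<^sup>2" by (intro power_mono) auto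
  also have "\<dots> < 12 * (1 + \<beta> / 2)\<^sup>2"
    unfolding power_mult_distrib using pi_square_less assms(1) by (intro mult_strict_right_mono) auto
  finally have strict: "(\<theta> + \<epsilon> * pi)\<^sup>2 < 12 * (1 + \<beta> / 2)\<^sup>2" by simp
  \<comment> \<open>With \<open>c = (1 + \<beta> / 2)^2\<close> the real part exceeds
    \<open>4 c - 12 c / 4 = c\<close>, and \<open>c\<close> is at least 1.\<close>
  have "(2 + \<beta>)\<^sup>2 \<le> L\<^sup>2" using assms(1,3) by (intro power_mono) (auto simp: L_def)
  moreover have "(2 + \<beta>)\<^sup>2 = 4 * (1 + \<beta> / 2)\<^sup>2" by (simp add: power2_eq_square field_simps)
  moreover have "1 \<le> (1 + \<beta> / 2)\<^sup>2" using assms(1) by simp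
  ultimately show "1 - \<beta> / 2 < Re ((sqrt_pole T r \<theta> \<epsilon>)\<^sup>2)"
    unfolding Re using strict assms(1) by linarith
  have "ln r \<le> 0" using assms(4,5) by simp
  then have "L\<^sup>2 \<le> T\<^sup>2" using assms(1,3) by (intro power_mono) (auto simp: L_def)
  then show "Re ((sqrt_pole T r \<theta> \<epsilon>)\<^sup>2) \<le> T\<^sup>2" unfolding Re by (smt (verit) zero_le_power2 zero_le_divide_iff)
qed

text \<open>This is where the step size is decisive. With \<open>L = T + ln r / 2\<close>, the pole
  has \<open>\<bar>Im u\<bar> \<ge> L pi (1 - \<beta> / 2)\<close>, and
  \<open>h = (2 - \<beta>) pi^2\<close> makes the decay of \<delta> there at least
  \<open>exp (-L)\<close>. The residue has size of order \<open>exp (ln r / 2)\<close>, so the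
  product no longer depends on \<open>r\<close>.\<close>

lemma norm_residue_term_le:
  assumes "\<beta> < 2" "\<bar>\<theta>\<bar> = \<beta> * pi / 2" "2 \<le> T + ln r / 2" "r > 0" "\<epsilon> \<in> {1, -1}"
  defines "s \<equiv> sqrt_pole T r \<theta> \<epsilon>"
  shows "norm (exp (s - of_real T) * delta_fun (hpar \<beta>) (s\<^sup>2)) \<le> 2 * exp (- T)"
proof -
  define L where "L = T + ln r / 2"
  define h where "h = hpar \<beta>"
  have h: "h > 0" using hpar_pos assms(1) by (simp add: h_def)
  have L: "L > 0" "2 \<le> L" using assms(3) by (auto simp: L_def)
  have Im: "Im (s\<^sup>2) = L * (\<theta> + \<epsilon> * pi)"
    by (simp add: s_def sqrt_pole_def power2_eq_square flip: L_def)
  have "pi * (1 - \<beta> / 2) \<le> \<bar>\<theta> + \<epsilon> * pi\<bar>"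
  proof -
    have ep: "\<bar>\<epsilon> * pi\<bar> = pi" using assms(5) by auto
    have "pi - \<bar>\<theta>\<bar> \<le> \<bar>\<theta> + \<epsilon> * pi\<bar>" using ep by linarith
    then show ?thesis using assms(2) by (simp add: algebra_simps)
  qed
  then have "L * (pi * (1 - \<beta> / 2)) \<le> \<bar>Im (s\<^sup>2)\<bar>"
    using L by (simp add: Im abs_mult)
  then have "2 * pi * (L * (pi * (1 - \<beta> / 2))) / h \<le> 2 * pi * \<bar>Im (s\<^sup>2)\<bar> / h"
    using h by (intro divide_right_mono mult_left_mono) auto
  moreover have "2 * pi * (L * (pi * (1 - \<beta> / 2))) / h = L"
  proof -
    have eq: "2 * pi * (L * (pi * (1 - \<beta> / 2))) = L * h"
      by (simp add: h_def hpar_def power2_eq_square field_simps)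
    show ?thesis unfolding eq using h by simp
  qed
  ultimately have eL: "exp (- (2 * pi * \<bar>Im (s\<^sup>2)\<bar> / h)) \<le> exp (- L)" by simp
  have "exp (- L) \<le> 1 / 2"
  proof -
    have "2 \<le> exp L" using exp_ge_add_one_self[of L] L by linarith
    then show ?thesis by (simp add: exp_minus field_simps)
  qed
  moreover have "Im (s\<^sup>2) \<noteq> 0"
  proof -
    have "0 < L * (pi * (1 - \<beta> / 2))" using L assms(1) by simp
    then show ?thesis using \<open>L * (pi * (1 - \<beta> / 2)) \<le> \<bar>Im (s\<^sup>2)\<bar>\<close> by linarith
  qed
  ultimately have "norm (delta_fun h (s\<^sup>2)) \<le> 2 * exp (- (2 * pi * \<bar>Im (s\<^sup>2)\<bar> / h))"
    using eL by (intro norm_delta_fun_le h) linarith+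
  also have "\<dots> \<le> 2 * exp (- L)" using eL by simp
  finally have d: "norm (delta_fun h (s\<^sup>2)) \<le> 2 * exp (- L)" .
  have "norm (exp (s - of_real T)) = exp (ln r / 2)"
    by (simp add: s_def sqrt_pole_def)
  then have "norm (exp (s - of_real T) * delta_fun h (s\<^sup>2)) \<le> exp (ln r / 2) * (2 * exp (- L))"
    unfolding norm_mult using d by (intro mult_mono) auto
  also have "\<dots> = 2 * exp (- T)" by (simp add: L_def flip: exp_add)
  finally show ?thesis by (simp add: h_def)
qed

text \<open>The 8 is twice the sum of two residue terms of size \<open>2 exp (-T)\<close>. The terms
  \<open>exp 1\<close> and 1 over the cosine come from the two ends of the segment:
  \<open>x0 \<le> 1\<close> gives \<open>X0 \<le> exp (1 - T)\<close>, and
  \<open>sqrt x1 \<ge> 2 T\<close> gives \<open>X1 \<ge> exp T\<close>.\<close>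

lemma trapezoid_error_large_radius:
  fixes \<beta> \<theta> r T h :: real and Nt :: nat and z I :: complex
  defines "T \<equiv> Tpar \<beta> Nt" and "h \<equiv> hpar \<beta>" and "z \<equiv> ray_point r \<theta>"
  assumes \<beta>: "0 \<le> \<beta>" "\<beta> < 2" and \<theta>: "\<bar>\<theta>\<bar> = \<beta> * pi / 2" and r: "exp (4 + 2 * \<beta> - 2 * T) \<le> r" "r \<le> 1"
    and I: "((\<lambda>u. f_fun T u z * delta_fun h u) has_contour_integral I) (Gamma_contour \<beta> T r)"
  shows "norm (h * (\<Sum>j=1..Nt. f_fun T (of_real (j * h)) z) - csqrt z)
     \<le> norm I + ((exp 1 + 1) / cos (\<beta> * pi / 4) + 8) * exp (- T)"
proof -
  define L where "L = T + ln r / 2"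
  define x0 where "x0 = 1 - \<beta> / 2"
  define x1 where "x1 = Nt * h + x0"
  have r0: "r > 0" using r(1) by (rule less_le_trans[OF exp_gt_zero])
  have \<theta>pi: "\<bar>\<theta>\<bar> < pi" using half_turn_fraction_less_pi[OF \<beta>(2) \<theta>] .
  have T0: "T \<ge> 0" using Tpar_nonneg \<beta> by (simp add: T_def)
  have h0: "h > 0" using hpar_pos \<beta> by (simp add: h_def)
  have "4 + 2 * \<beta> - 2 * T \<le> ln r" using r(1) r0 by (simp add: ln_ge_iff)
  then have L2: "2 + \<beta> \<le> L" by (simp add: L_def)
  then have L0: "L > 0" "2 \<le> L" using \<beta> by simp_all
  have x0: "0 < x0" "x0 \<le> 1" using \<beta> by (simp_all add: x0_def)
  \<comment> \<open>The left edge must pass between the nodes 0 and \<open>h\<close>; in fact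
    \<open>h = 2 pi^2 x0\<close>.\<close>
  have x0h: "x0 < h"
  proof -
    have "1 \<le> pi\<^sup>2" using pi_gt3 by (intro one_le_power) linarith
    then have "1 < 2 * pi\<^sup>2" by linarith
    then have "x0 * 1 < x0 * (2 * pi\<^sup>2)" using x0 by (intro mult_strict_left_mono) auto
    then show ?thesis by (simp add: x0_def h_def hpar_def algebra_simps)
  qed
  have NtT: "Nt * h = 4 * T\<^sup>2" using Tpar_square \<beta> by (simp add: T_def h_def)
  have x1: "x1 = 4 * T\<^sup>2 + 1 - \<beta> / 2" by (simp add: x1_def NtT x0_def)
  have G: "Gamma_contour \<beta> T r = rect_boundary x0 x1 (2 * pi * L)"
    by (simp add: Gamma_contour_def x1 x0_def L_def)
  have x01: "x0 \<le> x1" using NtT by (simp add: x1_def)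
  define X0 where "X0 = exp (sqrt x0 - T)"
  define X1 where "X1 = exp (sqrt x1 - T)"
  define J where "J = 2 / pi * csqrt z * Arctan (of_real X1 / csqrt z) - 2 / pi * csqrt z * Arctan (of_real X0 / csqrt z)"
  have J: "((\<lambda>u. f_fun T u z) has_contour_integral J) (linepath (of_real x0) (of_real x1))"
    unfolding J_def X0_def X1_def z_def
    by (rule has_contour_integral_f_fun_segment[OF r0 \<theta>pi x0(1) x01])
  let ?sp = "sqrt_pole T r \<theta> 1" and ?sm = "sqrt_pole T r \<theta> (-1)"
  have L2': "2 + \<beta> \<le> T + ln r / 2" using L2 by (simp add: L_def)
  have T2: "T\<^sup>2 < x1" unfolding x1 using \<beta> by (simp add: add_nonneg_pos)
  have sp: "x0 < Re (?sp\<^sup>2)" "Re (?sp\<^sup>2) < x1" and sm: "x0 < Re (?sm\<^sup>2)" "Re (?sm\<^sup>2) < x1"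
    using Re_sqrt_pole_square_bounds[OF \<beta>(1) \<theta> L2' r(2) r0, of 1]
      Re_sqrt_pole_square_bounds[OF \<beta>(1) \<theta> L2' r(2) r0, of "-1"] T2 by (auto simp: x0_def)
  \<comment> \<open>The height \<open>2 pi L\<close> separates the two nearest poles from all
    others; both inequalities reduce to \<open>\<bar>\<theta>\<bar> < pi\<close>.\<close>
  have a: "L * (pi + \<bar>\<theta>\<bar>) < 2 * pi * L" "2 * pi * L < L * (3 * pi - \<bar>\<theta>\<bar>)"
  proof -
    have "L * (pi + \<bar>\<theta>\<bar>) < L * (2 * pi)" "L * (2 * pi) < L * (3 * pi - \<bar>\<theta>\<bar>)"
      using L0 \<theta>pi by (intro mult_strict_left_mono; linarith)+
    then show "L * (pi + \<bar>\<theta>\<bar>) < 2 * pi * L" "2 * pi * L < L * (3 * pi - \<bar>\<theta>\<bar>)"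
      by (simp_all only: mult_ac)
  qed
  define E where "E = exp (?sp - of_real T) * delta_fun h (?sp\<^sup>2) + exp (?sm - of_real T) * delta_fun h (?sm\<^sup>2)"
  let ?\<Sigma> = "h * (\<Sum>j=1..Nt. f_fun T (of_real (j * h)) z)"
  have "((\<lambda>u. f_fun T u z * delta_fun h u) has_contour_integral (J - ?\<Sigma> - 2 * \<i> * E)) (Gamma_contour \<beta> T r)"
    unfolding G E_def z_def
    by (rule contour_integral_delta_fun[OF r0 \<theta>pi h0 _ x0(1) x0h x1_def _ _ sp sm J[unfolded z_def]])
       (use a L0 in \<open>simp_all flip: L_def\<close>)
  then have "I = J - ?\<Sigma> - 2 * \<i> * E" using I has_contour_integral_unique by blast
  then have eq: "?\<Sigma> - csqrt z = (J - csqrt z) - I - 2 * \<i> * E" by simp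
  have "norm (?\<Sigma> - csqrt z) \<le> norm (J - csqrt z) + norm I + norm (2 * \<i> * E)"
    unfolding eq using norm_triangle_ineq4[of "(J - csqrt z) - I" "2 * \<i> * E"] norm_triangle_ineq4[of "J - csqrt z" I]
    by linarith
  moreover have "norm (2 * \<i> * E) \<le> 8 * exp (- T)"
  proof -
    have "norm E \<le> 2 * exp (- T) + 2 * exp (- T)"
      unfolding E_def h_def using \<beta> \<theta> L2' r0
      by (intro norm_triangle_mono norm_residue_term_le) auto
    then show ?thesis by (simp add: norm_mult)
  qed
  moreover have "norm (J - csqrt z) \<le> (exp 1 + 1) / cos (\<beta> * pi / 4) * exp (- T)"
  proof -
    note c = cos_half_angle(1)[OF \<beta>(2) \<theta>] and cpos = cos_half_angle(2)[OF \<beta>(2) \<theta>]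
    have "norm (J - csqrt z) \<le> (X0 + r / X1) / cos (\<theta> / 2)"
      unfolding J_def z_def by (rule norm_Arctan_difference_le[OF r0 \<theta>pi]) (simp_all add: X0_def X1_def)
    also have "X0 \<le> exp 1 * exp (- T)"
      unfolding X0_def using x0 by (simp flip: exp_add)
    moreover have "r / X1 \<le> exp (- T)"
    proof -
      have "2 * T = sqrt (4 * T\<^sup>2)" using T0 by (simp add: real_sqrt_mult)
      also have "\<dots> \<le> sqrt x1" using x0 by (intro real_sqrt_le_mono) (simp add: x1_def NtT)
      finally have "exp T \<le> X1" by (simp add: X1_def)
      then have "r / X1 \<le> 1 / exp T" using r by (intro frac_le) auto
      then show ?thesis by (simp add: exp_minus field_simps)
    qed
    ultimately have "norm (J - csqrt z) \<le> (exp 1 * exp (- T) + exp (- T)) / cos (\<theta> / 2)"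
      using cpos by (smt (verit) divide_right_mono)
    then show ?thesis by (simp add: c algebra_simps)
  qed
  ultimately show ?thesis by (simp add: algebra_simps)
qed

section \<open>Radii of order \<open>exp (-2 T)\<close>, where the sum is bounded term by
  term\<close>

lemma sum_inverse_squares_le: "(\<Sum>j=1..n. 1 / (real j)\<^sup>2) \<le> 2"
proof -
  have "(\<Sum>j=1..n. 1 / (real j)\<^sup>2) \<le> 2 - 1 / real n" if "n \<ge> 1"
    using that
  proof (induction n rule: dec_induct)
    case (step n)
    have "1 / (real (Suc n))\<^sup>2 \<le> 1 / (real n * real (Suc n))"
      using step(1) by (intro divide_left_mono) (auto simp: power2_eq_square)
    also have "\<dots> = 1 / real n - 1 / real (Suc n)"
      using step(1) by (simp add: field_simps)
    finally show ?case using step by simp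
  qed simp
  then show ?thesis by (cases "n = 0") (auto intro: order.trans)
qed

text \<open>For \<open>x = sqrt (j h)\<close> the right-hand side is a multiple of
  \<open>1 / j^2\<close>, which makes the sum over the nodes bounded in their number.\<close>

lemma exp_minus_div_le:
  fixes x :: real
  assumes "x > 0"
  shows "exp (- x) / x \<le> 27 / x ^ 4"
proof -
  have "x / 3 \<le> exp (x / 3)" using exp_ge_add_one_self[of "x / 3"] by linarith
  then have "(x / 3) ^ 3 \<le> exp (x / 3) ^ 3" using assms by (intro power_mono) auto
  also have "\<dots> = exp x" by (simp flip: exp_of_nat_mult)
  finally have "x ^ 3 \<le> 27 * exp x" by (simp add: power_divide)
  then show ?thesis using assms by (simp add: exp_minus field_simps eval_nat_numeral)
qed

definition node_weight :: "real \<Rightarrow> real \<Rightarrow> nat \<Rightarrow> real" where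
  "node_weight h T j = h * exp (sqrt (j * h) - T) / (pi * sqrt (j * h))"

text \<open>This makes the dependence on \<open>z\<close> rational: a weight free of
  \<open>z\<close> times \<open>z / (z - p)\<close> with a negative pole \<open>p\<close>.\<close>

lemma f_fun_node:
  fixes h T :: real and z :: complex
  assumes "h > 0" "j \<ge> 1"
  shows "h * f_fun T (of_real (j * h)) z
     = node_weight h T j * (z / (of_real (exp (2 * (sqrt (j * h) - T))) + z))"
proof -
  have c: "csqrt (of_real (j * h)) = of_real (sqrt (j * h))"
    using assms by (intro csqrt_of_real) simp
  have e: "exp (of_real (sqrt (j * h)) - of_real T) = complex_of_real (exp (sqrt (j * h) - T))"
    by (simp add: exp_of_real flip: of_real_diff)
  have e2: "exp (2 * (of_real (sqrt (j * h)) - of_real T)) = complex_of_real (exp (2 * (sqrt (j * h) - T)))"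
    by (metis exp_of_real of_real_diff of_real_mult of_real_numeral)
  show ?thesis
    unfolding f_fun_def c e e2 node_weight_def by (simp add: mult_ac)
qed

text \<open>Dropping \<open>r\<close> from the lower bound on the denominator leaves terms of size
  \<open>r exp T\<close> times a summable sequence, and \<open>r \<le> exp (8 - 2 T)\<close> turns
  this into \<open>exp (-T)\<close>. The 54 is 27 from \<open>exp_minus_div_le\<close> times the
  bound 2 on the sum of inverse squares; \<open>exp 4\<close> bounds the square root itself.\<close>

lemma trapezoid_error_small_radius:
  fixes \<beta> \<theta> r T h :: real and M :: nat and z :: complex
  defines "h \<equiv> hpar \<beta>" and "z \<equiv> ray_point r \<theta>"
  assumes \<beta>: "0 \<le> \<beta>" "\<beta> < 2" and \<theta>: "\<bar>\<theta>\<bar> = \<beta> * pi / 2" and r: "0 \<le> r" "r \<le> exp (4 + 2 * \<beta> - 2 * T)"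
  shows "norm (h * (\<Sum>j=1..M. f_fun T (of_real (j * h)) z) - csqrt z)
     \<le> (54 * exp 8 / (h * cos (\<beta> * pi / 4)) + exp 4) * exp (- T)"
proof -
  define \<kappa> where "\<kappa> = cos (\<beta> * pi / 4)"
  have h0: "h > 0" using hpar_pos \<beta> by (simp add: h_def)
  have c: "cos (\<theta> / 2) = \<kappa>" and \<kappa>: "\<kappa> > 0"
    using cos_half_angle[OF \<beta>(2) \<theta>] by (simp_all add: \<kappa>_def)
  have re: "r \<le> exp 8 * exp (- (2 * T))"
  proof -
    have "r \<le> exp (8 - 2 * T)" using r(2) \<beta> by (smt (verit) exp_le_cancel_iff)
    then show ?thesis by (simp flip: exp_add)
  qed
  have bound: "norm (h * f_fun T (of_real (j * h)) z) \<le> 27 * exp 8 / (h * \<kappa>) * exp (- T) * (1 / (real j)\<^sup>2)"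
    if "j \<ge> 1" for j :: nat
  proof -
    define x where "x = sqrt (j * h)"
    have x: "x > 0" and x2: "x\<^sup>2 = j * h" using that h0 by (simp_all add: x_def)
    define E where "E = exp (x - T)"
    have E: "E > 0" by (simp add: E_def)
    have E2: "exp (2 * (x - T)) = E\<^sup>2" unfolding E_def by (rule exp_double)
    have "\<kappa> * E\<^sup>2 \<le> \<kappa> * (E\<^sup>2 + r)" using \<kappa> r by simp
    also have "\<dots> \<le> norm (of_real (E\<^sup>2) + z)"
      using norm_add_ray_point_ge[of "E\<^sup>2" r \<theta>] r by (simp add: z_def c)
    finally have den: "\<kappa> * E\<^sup>2 \<le> norm (of_real (E\<^sup>2) + z)" .
    have pos: "0 < \<kappa> * E\<^sup>2" using \<kappa> E by simp
    have "norm (h * f_fun T (of_real (j * h)) z) = node_weight h T j * (r / norm (of_real (E\<^sup>2) + z))"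
      unfolding f_fun_node[OF h0 that] x_def[symmetric] E2
      using h0 r by (simp add: norm_mult norm_divide z_def norm_ray_point node_weight_def)
    also have "\<dots> \<le> node_weight h T j * (r / (\<kappa> * E\<^sup>2))"
      using den pos r h0 by (intro mult_left_mono frac_le) (auto simp: node_weight_def)
    also have "\<dots> = h * r / (pi * \<kappa>) * (1 / E / x)"
      using E x \<kappa> unfolding node_weight_def x_def[symmetric] E_def[symmetric] by (simp add: field_simps power2_eq_square)
    also have "1 / E / x = exp T * (exp (- x) / x)"
      by (simp add: E_def exp_diff exp_minus field_simps)
    also have "h * r / (pi * \<kappa>) * (exp T * (exp (- x) / x)) \<le> h * r / \<kappa> * (exp T * (27 / x ^ 4))"
    proof (rule mult_mono)
      have "h * r / (pi * \<kappa>) \<le> h * r / (1 * \<kappa>)"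
        using h0 r \<kappa> pi_gt3 by (intro divide_left_mono mult_right_mono) auto
      then show "h * r / (pi * \<kappa>) \<le> h * r / \<kappa>" by simp
      show "exp T * (exp (- x) / x) \<le> exp T * (27 / x ^ 4)"
        by (intro mult_left_mono exp_minus_div_le[OF x]) simp
    qed (use h0 r \<kappa> x in auto)
    also have "\<dots> = 27 * exp T / (h * \<kappa>) * (1 / (real j)\<^sup>2) * r"
    proof -
      have "x ^ 4 = (j * h)\<^sup>2" unfolding x2[symmetric] by simp
      then show ?thesis using h0 that \<kappa> by (simp add: field_simps power2_eq_square)
    qed
    also have "\<dots> \<le> 27 * exp T / (h * \<kappa>) * (1 / (real j)\<^sup>2) * (exp 8 * exp (- (2 * T)))"
      using re h0 \<kappa> by (intro mult_left_mono) auto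
    also have "\<dots> = 27 * exp 8 / (h * \<kappa>) * (exp T * exp (- (2 * T))) * (1 / (real j)\<^sup>2)"
      by simp
    also have "exp T * exp (- (2 * T)) = exp (- T)" by (simp flip: exp_add)
    finally show ?thesis .
  qed
  have "norm (h * (\<Sum>j=1..M. f_fun T (of_real (j * h)) z)) = norm (\<Sum>j=1..M. h * f_fun T (of_real (j * h)) z)"
    by (simp add: sum_distrib_left)
  also have "\<dots> \<le> (\<Sum>j=1..M. 27 * exp 8 / (h * \<kappa>) * exp (- T) * (1 / (real j)\<^sup>2))"
    by (rule sum_norm_le) (use bound in auto)
  also have "\<dots> = 27 * exp 8 / (h * \<kappa>) * exp (- T) * (\<Sum>j=1..M. 1 / (real j)\<^sup>2)"
    by (rule sum_distrib_left[symmetric])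
  also have "\<dots> \<le> 27 * exp 8 / (h * \<kappa>) * exp (- T) * 2"
    using h0 \<kappa> sum_inverse_squares_le by (intro mult_left_mono) auto
  finally have 1: "norm (h * (\<Sum>j=1..M. f_fun T (of_real (j * h)) z)) \<le> 54 * exp 8 / (h * \<kappa>) * exp (- T)"
    by simp
  have "norm (csqrt z) = sqrt r" using r by (simp add: z_def norm_ray_point)
  also have "\<dots> \<le> sqrt ((exp 4 * exp (- T))\<^sup>2)"
    using re by (intro real_sqrt_le_mono) (simp add: power2_eq_square flip: exp_add)
  finally have 2: "norm (csqrt z) \<le> exp 4 * exp (- T)" by simp
  show ?thesis
    using norm_triangle_le_diff[OF add_mono[OF 1 2]] by (simp add: \<kappa>_def distrib_right)
qed

lemma rays_cases:
  assumes "z \<in> rays \<beta>" "0 \<le> \<beta>"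
  obtains r \<theta> s where "z = ray_point r \<theta>" "0 \<le> r" "r \<le> 1" "\<bar>\<theta>\<bar> = \<beta> * pi / 2" "s \<in> {-1, 1}"
    "z = of_real r * exp (of_real s * \<i> * of_real (\<beta> * pi / 2))"
proof -
  obtain r s where rs: "z = of_real r * exp (of_real s * \<i> * of_real (\<beta> * pi / 2))" "0 \<le> r" "r \<le> 1" "s \<in> {-1, 1}"
    using assms(1) by (auto simp: rays_def)
  have "z = ray_point r (s * (\<beta> * pi / 2))"
    by (simp add: rs(1) ray_point_def mult_ac)
  moreover have "\<bar>s * (\<beta> * pi / 2)\<bar> = \<beta> * pi / 2"
    using rs(4) assms(2) by (auto simp: abs_mult)
  ultimately show thesis using that rs by blast
qed

lemma trapezoid_error:
  assumes \<beta>: "0 \<le> \<beta>" "\<beta> < 2"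
    and K: "\<exists>K. \<forall>\<^sub>F Nt in sequentially.
             \<forall>r \<in> {exp (4 + 2 * \<beta> - 2 * Tpar \<beta> Nt) .. 1}. \<forall>s \<in> {-1, 1 :: real}.
               \<exists>I. ((\<lambda>u. f_fun (Tpar \<beta> Nt) u
                          (complex_of_real r * exp (complex_of_real s * \<i> * complex_of_real (\<beta> * pi / 2)))
                        * delta_fun (hpar \<beta>) u)
                     has_contour_integral I) (Gamma_contour \<beta> (Tpar \<beta> Nt) r)
                   \<and> norm I \<le> K * exp (- Tpar \<beta> Nt)"
  obtains C where "C \<ge> 0" "\<forall>\<^sub>F Nt in sequentially. \<forall>z\<in>rays \<beta>.
      norm (hpar \<beta> * (\<Sum>j=1..Nt. f_fun (Tpar \<beta> Nt) (of_real (j * hpar \<beta>)) z) - csqrt z)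
        \<le> C * exp (- Tpar \<beta> Nt)"
proof -
  obtain K where K: "\<forall>\<^sub>F Nt in sequentially.
             \<forall>r \<in> {exp (4 + 2 * \<beta> - 2 * Tpar \<beta> Nt) .. 1}. \<forall>s \<in> {-1, 1 :: real}.
               \<exists>I. ((\<lambda>u. f_fun (Tpar \<beta> Nt) u
                          (complex_of_real r * exp (complex_of_real s * \<i> * complex_of_real (\<beta> * pi / 2)))
                        * delta_fun (hpar \<beta>) u)
                     has_contour_integral I) (Gamma_contour \<beta> (Tpar \<beta> Nt) r)
                   \<and> norm I \<le> K * exp (- Tpar \<beta> Nt)"
    using assms(3) by blast
  define C1 where "C1 = K + ((exp 1 + 1) / cos (\<beta> * pi / 4) + 8)"
  define C2 where "C2 = 54 * exp 8 / (hpar \<beta> * cos (\<beta> * pi / 4)) + exp 4"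
  \<comment> \<open>\<open>K\<close>, and with it \<open>C1\<close>, may be negative; the absolute
    values make \<open>C\<close> nonnegative.\<close>
  define C where "C = \<bar>C1\<bar> + \<bar>C2\<bar>"
  have "\<forall>\<^sub>F Nt in sequentially. \<forall>z\<in>rays \<beta>.
      norm (hpar \<beta> * (\<Sum>j=1..Nt. f_fun (Tpar \<beta> Nt) (of_real (j * hpar \<beta>)) z) - csqrt z)
        \<le> C * exp (- Tpar \<beta> Nt)"
    using K
  proof eventually_elim
    case (elim Nt)
    show ?case
    proof
      fix z assume "z \<in> rays \<beta>"
      then obtain r \<theta> s where z: "z = ray_point r \<theta>" "0 \<le> r" "r \<le> 1" "\<bar>\<theta>\<bar> = \<beta> * pi / 2" "s \<in> {-1, 1}"
        "z = of_real r * exp (of_real s * \<i> * of_real (\<beta> * pi / 2))"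
        using \<beta>(1) by (rule rays_cases)
      let ?err = "norm (hpar \<beta> * (\<Sum>j=1..Nt. f_fun (Tpar \<beta> Nt) (of_real (j * hpar \<beta>)) z) - csqrt z)"
      have "?err \<le> max C1 C2 * exp (- Tpar \<beta> Nt)"
      proof (cases "exp (4 + 2 * \<beta> - 2 * Tpar \<beta> Nt) \<le> r")
        case True
        then have "r \<in> {exp (4 + 2 * \<beta> - 2 * Tpar \<beta> Nt) .. 1}" using z(3) by simp
        with elim z(5) obtain I where I: "((\<lambda>u. f_fun (Tpar \<beta> Nt) u z * delta_fun (hpar \<beta>) u)
                     has_contour_integral I) (Gamma_contour \<beta> (Tpar \<beta> Nt) r)"
            "norm I \<le> K * exp (- Tpar \<beta> Nt)"
          unfolding z(6) by blast
        have "?err \<le> norm I + ((exp 1 + 1) / cos (\<beta> * pi / 4) + 8) * exp (- Tpar \<beta> Nt)"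
          unfolding z(1) by (rule trapezoid_error_large_radius[OF \<beta> z(4) True z(3) I(1)[unfolded z(1)]])
        also have "\<dots> \<le> C1 * exp (- Tpar \<beta> Nt)" using I(2) by (simp add: C1_def distrib_right)
        also have "\<dots> \<le> max C1 C2 * exp (- Tpar \<beta> Nt)" by (intro mult_right_mono) auto
        finally show ?thesis .
      next
        case False
        then have "?err \<le> C2 * exp (- Tpar \<beta> Nt)"
          unfolding z(1) C2_def by (intro trapezoid_error_small_radius[OF \<beta> z(4,2)]) simp
        also have "\<dots> \<le> max C1 C2 * exp (- Tpar \<beta> Nt)" by (intro mult_right_mono) auto
        finally show ?thesis .
      qed
      also have "\<dots> \<le> C * exp (- Tpar \<beta> Nt)"
        by (intro mult_right_mono) (auto simp: C_def)
      finally show "?err \<le> C * exp (- Tpar \<beta> Nt)" .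
    qed
  qed
  then show thesis using that[of C] by (simp add: C_def)
qed

subsection \<open>The rational approximation\<close>

text \<open>The distance to 1 is convex along a ray segment, so it is largest at an end: 0, at
  distance 1, or the point on the unit circle, at distance
  \<open>sqrt (2 - 2 cos \<theta>)\<close>.\<close>

lemma norm_rays_minus_one_le:
  assumes "z \<in> rays \<beta>"
  shows "norm (z - 1) \<le> max 1 (sqrt (2 - 2 * cos (\<beta> * pi / 2)))"
proof -
  define \<theta> where "\<theta> = \<beta> * pi / 2"
  define D where "D = sqrt (2 - 2 * cos \<theta>)"
  obtain r s where rs: "z = of_real r * exp (of_real s * \<i> * of_real \<theta>)" "0 \<le> r" "r \<le> 1" "s \<in> {-1, 1}"
    using assms by (auto simp: rays_def \<theta>_def)
  define e where "e = exp (of_real s * \<i> * of_real \<theta>)"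
  have e: "e = cis (s * \<theta>)" by (simp add: e_def cis_conv_exp mult_ac)
  have "cos (s * \<theta>) = cos \<theta>" using rs(4) by auto
  have "(norm (e - 1))\<^sup>2 = (cos (s * \<theta>) - 1)\<^sup>2 + (sin (s * \<theta>))\<^sup>2"
    by (simp add: cmod_power2 e)
  also have "\<dots> = 2 - 2 * cos (s * \<theta>)"
    using sin_cos_squared_add[of "s * \<theta>"] by (simp add: power2_eq_square algebra_simps)
  finally have "(norm (e - 1))\<^sup>2 = 2 - 2 * cos \<theta>" using \<open>cos (s * \<theta>) = cos \<theta>\<close> by simp
  then have De: "norm (e - 1) = D" unfolding D_def by (metis norm_ge_zero real_sqrt_abs abs_of_nonneg)
  have "z - 1 = - of_real (1 - r) + of_real r * (e - 1)"
    by (simp add: rs(1) e_def algebra_simps)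
  then have "norm (z - 1) \<le> norm (- complex_of_real (1 - r)) + norm (of_real r * (e - 1))"
    by (metis norm_triangle_ineq)
  also have "\<dots> = (1 - r) * 1 + r * D"
    unfolding norm_minus_cancel norm_mult norm_of_real De using rs(2,3) by simp
  also have "\<dots> \<le> (1 - r) * max 1 D + r * max 1 D"
    using rs(2,3) by (intro add_mono mult_left_mono) auto
  also have "\<dots> = max 1 D" by (simp add: algebra_simps)
  finally show ?thesis by (simp add: D_def \<theta>_def)
qed

text \<open>The rays lie in a disc about 1 that excludes the half-line ending at -1, so a geometric
  series in \<open>(z - 1) / (p - 1)\<close> converges at a rate independent of \<open>p\<close>.\<close>
lemma pole_poly_approx:
  assumes "0 \<le> \<beta>" "\<beta> < 2"
  obtains \<rho> :: real where "0 < \<rho>" "\<rho> < 1"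
    "\<And>p n. p \<le> -1 \<Longrightarrow> \<exists>Q. degree Q \<le> n \<and>
        (\<forall>z\<in>rays \<beta>. norm (poly Q z - of_real p / (z - of_real p)) \<le> \<rho> ^ n / (1 - \<rho>))"
proof -
  define R where "R = max 1 (sqrt (2 - 2 * cos (\<beta> * pi / 2)))"
  define \<rho> where "\<rho> = R / 2"
  \<comment> \<open>This is where \<open>\<beta> < 2\<close> enters: it makes \<open>R\<close>
    smaller than 2, the distance from 1 to -1.\<close>
  have "cos pi < cos (\<beta> * pi / 2)"
    using assms by (intro cos_monotone_0_pi) auto
  then have "sqrt (2 - 2 * cos (\<beta> * pi / 2)) < sqrt (2\<^sup>2)" by (intro real_sqrt_less_mono) auto
  then have R: "1 \<le> R" "R < 2" by (auto simp: R_def)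
  then have \<rho>: "0 < \<rho>" "\<rho> < 1" by (auto simp: \<rho>_def)
  have "\<exists>Q. degree Q \<le> n \<and>
        (\<forall>z\<in>rays \<beta>. norm (poly Q z - of_real p / (z - of_real p)) \<le> \<rho> ^ n / (1 - \<rho>))"
    if p: "p \<le> -1" for p :: real and n
  proof -
    define P where "P = complex_of_real p"
    have P1: "norm (P - 1) = 1 - p"
    proof -
      have "P - 1 = of_real (p - 1)" by (simp add: P_def)
      then show ?thesis using p by (simp only: norm_of_real)
    qed
    then have P0: "P - 1 \<noteq> 0" using p by auto
    define Q where "Q = smult (- (P / (P - 1))) (\<Sum>k\<le>n. [:- 1 / (P - 1), 1 / (P - 1):] ^ k)"
    have "degree ([:- 1 / (P - 1), 1 / (P - 1):] ^ k) \<le> n" if "k \<le> n" for k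
    proof -
      have "degree ([:- 1 / (P - 1), 1 / (P - 1):] ^ k) \<le> degree [:- 1 / (P - 1), 1 / (P - 1):] * k"
        by (rule degree_power_le)
      also have "\<dots> \<le> 1 * k" by (intro mult_right_mono) auto
      finally show ?thesis using that by simp
    qed
    then have deg: "degree Q \<le> n"
      unfolding Q_def by (intro order.trans[OF degree_smult_le] degree_sum_le) auto
    have "norm (poly Q z - P / (z - P)) \<le> \<rho> ^ n / (1 - \<rho>)" if z: "z \<in> rays \<beta>" for z
    proof -
      define q where "q = (z - 1) / (P - 1)"
      have "norm q = norm (z - 1) / (1 - p)" by (simp add: q_def norm_divide P1)
      also have "\<dots> \<le> R / 2"
        using norm_rays_minus_one_le[OF z] p R by (intro frac_le) (auto simp: R_def)
      finally have q: "norm q \<le> \<rho>" by (simp add: \<rho>_def)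
      have q1: "1 - \<rho> \<le> norm (1 - q)"
        using norm_triangle_ineq2[of 1 q] q by simp
      then have q0: "1 - q \<noteq> 0" using \<rho> by auto
      have pq: "poly [:- 1 / (P - 1), 1 / (P - 1):] z = q"
        by (simp add: q_def diff_divide_distrib)
      have "poly Q z = - (P / (P - 1)) * (\<Sum>k\<le>n. q ^ k)"
        unfolding Q_def by (simp only: poly_smult poly_sum poly_power pq)
      also have "(\<Sum>k\<le>n. q ^ k) = (1 - q ^ Suc n) / (1 - q)"
        using sum_gp0[of q n] q0 by auto
      finally have Qz: "poly Q z = - (P / (P - 1)) * ((1 - q ^ Suc n) / (1 - q))" .
      have "(P - 1) * q = z - 1" using P0 by (simp add: q_def)
      then have "z - P = - ((P - 1) * (1 - q))" by (simp add: right_diff_distrib)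
      then have zP: "P / (z - P) = - (P / (P - 1)) * (1 / (1 - q))" by simp
      have "poly Q z - P / (z - P) = P / (P - 1) * (q ^ Suc n / (1 - q))"
        unfolding Qz zP by (simp add: diff_divide_distrib right_diff_distrib)
      then have "norm (poly Q z - P / (z - P)) = norm (P / (P - 1)) * (norm q ^ Suc n / norm (1 - q))"
        by (simp only: norm_mult norm_divide norm_power)
      also have "\<dots> \<le> 1 * (\<rho> ^ n / (1 - \<rho>))"
      proof (rule mult_mono)
        have "norm P = - p" using p by (simp add: P_def)
        then show "norm (P / (P - 1)) \<le> 1" unfolding norm_divide P1 using p by (simp add: field_simps)
        have "norm q ^ Suc n \<le> \<rho> ^ Suc n" using q by (intro power_mono) auto
        also have "\<dots> \<le> \<rho> ^ n" using \<rho> by (intro power_decreasing) auto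
        finally show "norm q ^ Suc n / norm (1 - q) \<le> \<rho> ^ n / (1 - \<rho>)"
          using q1 \<rho> by (intro frac_le) auto
      qed auto
      finally show ?thesis by simp
    qed
    then show ?thesis using deg by (auto simp: P_def)
  qed
  then show thesis using that \<rho> by blast
qed

section \<open>Matching the prescribed poles, the weights and the rate\<close>

lemma Tpar_four_mult: "\<beta> < 2 \<Longrightarrow> Tpar \<beta> (4 * n) = sqrt (hpar \<beta>) * sqrt n"
  by (simp add: Tpar_def real_sqrt_mult)

lemma sqrt_hpar: "sqrt (hpar \<beta>) = sqrt (2 - \<beta>) * pi"
  by (simp add: hpar_def real_sqrt_mult)

lemma pole_eq:
  assumes "\<beta> < 2"
  shows "pole \<beta> n j = of_real (- exp (2 * (sqrt (j * hpar \<beta>) - Tpar \<beta> (4 * n))))"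
proof -
  have "- (2 * sqrt (2 - \<beta>) * pi) * (sqrt n - sqrt j) = 2 * (sqrt (j * hpar \<beta>) - Tpar \<beta> (4 * n))"
    unfolding Tpar_four_mult[OF assms] real_sqrt_mult[of j] sqrt_hpar by (simp add: algebra_simps)
  then show ?thesis unfolding pole_def by (simp only:)
qed

text \<open>The exponent is at most \<open>T\<close> up to the last node, and the denominator is at
  least \<open>sqrt h\<close> from the first node on.\<close>

lemma node_weight_bounds:
  assumes "h > 0" "j \<ge> 1" "sqrt (j * h) \<le> 2 * T"
  shows "0 \<le> node_weight h T j" "node_weight h T j \<le> sqrt h * exp T"
proof -
  define x where "x = sqrt (j * h)"
  have "1 * h \<le> j * h" using assms by (intro mult_right_mono) auto
  then have x: "sqrt h \<le> x" unfolding x_def by simp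
  have s: "sqrt h > 0" using assms by simp
  show "0 \<le> node_weight h T j" using assms by (simp add: node_weight_def)
  have "node_weight h T j \<le> h * exp T / (1 * sqrt h)"
    unfolding node_weight_def x_def[symmetric]
    using assms x s pi_gt3 by (intro frac_le mult_left_mono mult_mono) (auto simp: x_def)
  also have "\<dots> = sqrt h * exp T"
    using assms real_div_sqrt[of h] by (simp add: field_simps)
  finally show "node_weight h T j \<le> sqrt h * exp T" .
qed

lemma z_minus_pole_nonzero:
  assumes "0 \<le> \<beta>" "\<beta> < 2" "z \<in> rays \<beta>" "p < 0"
  shows "z - of_real p \<noteq> 0"
proof -
  obtain r \<theta> where z: "z = ray_point r \<theta>" "0 \<le> r" "\<bar>\<theta>\<bar> = \<beta> * pi / 2"
    using rays_cases[OF assms(3,1)] by metis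
  have "0 < cos (\<theta> / 2) * (- p + r)"
    using cos_half_angle(2)[OF assms(2) z(3)] z(2) assms(4) by simp
  also have "\<dots> \<le> norm (of_real (- p) + z)"
    unfolding z(1) using z(2) assms(4) by (intro norm_add_ray_point_ge) auto
  finally show ?thesis by (auto simp: algebra_simps)
qed

text \<open>Since \<open>N + n \<le> (sqrt N + C)^2\<close>, the additional degree raises the square
  root by at most \<open>C\<close>, whatever \<open>N\<close> is.\<close>

lemma exp_Tpar_le:
  assumes "\<beta> < 2" "real n \<le> C * sqrt N" "0 \<le> C"
  shows "exp (- Tpar \<beta> (4 * N)) \<le> exp (sqrt (hpar \<beta>) * C) * exp (- pi * sqrt ((2 - \<beta>) * real (N + n)))"
proof -
  have "real (N + n) \<le> (sqrt N + C)\<^sup>2"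
  proof -
    have "0 \<le> C * sqrt N" using assms(3) by simp
    moreover have "(sqrt N + C)\<^sup>2 = N + 2 * (C * sqrt N) + C\<^sup>2" by (simp add: power2_sum)
    ultimately show ?thesis
      using assms(2) zero_le_power2[of C] unfolding of_nat_add by linarith
  qed
  then have "sqrt (real (N + n)) \<le> sqrt N + C"
    using assms(3) by (intro real_le_lsqrt) auto
  then have "sqrt (hpar \<beta>) * sqrt (real (N + n)) \<le> sqrt (hpar \<beta>) * (sqrt N + C)"
    using hpar_pos[OF assms(1)] by (intro mult_left_mono) auto
  moreover have "pi * sqrt ((2 - \<beta>) * real (N + n)) = sqrt (hpar \<beta>) * sqrt (real (N + n))"
    unfolding sqrt_hpar real_sqrt_mult by simp
  ultimately have "- Tpar \<beta> (4 * N) \<le> sqrt (hpar \<beta>) * C + - pi * sqrt ((2 - \<beta>) * real (N + n))"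
    unfolding Tpar_four_mult[OF assms(1)] by (simp add: algebra_simps)
  then show ?thesis by (simp flip: exp_add)
qed

theorem theorem5p2:
  fixes \<beta> :: real
  assumes "0 \<le> \<beta>" and "\<beta> < 2"
  assumes "\<exists>K. \<forall>\<^sub>F Nt in sequentially.
             \<forall>r \<in> {exp (4 + 2 * \<beta> - 2 * Tpar \<beta> Nt) .. 1}. \<forall>s \<in> {-1, 1 :: real}.
               \<exists>I. ((\<lambda>u. f_fun (Tpar \<beta> Nt) u
                          (complex_of_real r * exp (complex_of_real s * \<i> * complex_of_real (\<beta> * pi / 2)))
                        * delta_fun (hpar \<beta>) u)
                     has_contour_integral I) (Gamma_contour \<beta> (Tpar \<beta> Nt) r)
                   \<and> norm I \<le> K * exp (- Tpar \<beta> Nt)"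
  shows "\<exists>C1 C2. \<forall>\<^sub>F N1 in sequentially.
           \<exists>(a :: nat \<Rightarrow> complex) (b :: complex poly) (N2 :: nat).
             real N2 \<le> C1 * sqrt (real N1) \<and> degree b \<le> N2 \<and>
             (\<forall>z \<in> rays \<beta>.
                norm ((\<Sum>j = 1..N1. a j / (z - pole \<beta> N1 j)) + poly b z - csqrt z)
                  \<le> C2 * exp (- pi * sqrt ((2 - \<beta>) * real (N1 + N2))))"
proof -
  note \<beta> = assms(1,2)
  define h where "h = hpar \<beta>"
  have h: "h > 0" using hpar_pos \<beta> by (simp add: h_def)
  obtain C where C: "C \<ge> 0" "\<forall>\<^sub>F Nt in sequentially. \<forall>z\<in>rays \<beta>.
      norm (hpar \<beta> * (\<Sum>j=1..Nt. f_fun (Tpar \<beta> Nt) (of_real (j * hpar \<beta>)) z) - csqrt z)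
        \<le> C * exp (- Tpar \<beta> Nt)"
    by (rule trapezoid_error[OF assms])
  obtain \<rho> :: real where \<rho>: "0 < \<rho>" "\<rho> < 1" and approx:
    "\<And>p n. p \<le> -1 \<Longrightarrow> \<exists>Q. degree Q \<le> n \<and>
        (\<forall>z\<in>rays \<beta>. norm (poly Q z - of_real p / (z - of_real p)) \<le> \<rho> ^ n / (1 - \<rho>))"
    by (rule pole_poly_approx[OF \<beta>]) (blast intro: that)
  define lam where "lam = - ln \<rho>"
  have lam: "lam > 0" using \<rho> by (simp add: lam_def)
  \<comment> \<open>From \<open>n = \<lceil>3 T / lam\<rceil>\<close> and
    \<open>T = sqrt h sqrt N\<close>; the 1 pays for rounding up, as
    \<open>sqrt N \<ge> 1\<close>.\<close>
  define C1 where "C1 = 3 * sqrt h / lam + 1"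
  have C1: "C1 \<ge> 0" using h lam by (simp add: C1_def)
  \<comment> \<open>There are \<open>3 N\<close> replaced fractions, each with error at most
    \<open>sqrt h / (1 - \<rho>)\<close> times \<open>exp (-2 T)\<close>, and
    \<open>N \<le> (2 / h) exp T\<close> because \<open>T^2 = h N\<close>.\<close>
  define B where "B = 6 / (sqrt h * (1 - \<rho>))"
  have B: "B \<ge> 0" using h \<rho> by (simp add: B_def)
  define C2 where "C2 = (B + C) * exp (sqrt h * C1)"
  from C(2)[unfolded eventually_sequentially, folded h_def] obtain N0 where N0: "\<forall>Nt\<ge>N0. \<forall>z\<in>rays \<beta>.
      norm (h * (\<Sum>j=1..Nt. f_fun (Tpar \<beta> Nt) (of_real (real j * h)) z) - csqrt z) \<le> C * exp (- Tpar \<beta> Nt)" ..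
  have "\<exists>(a :: nat \<Rightarrow> complex) (b :: complex poly) (N2 :: nat).
             real N2 \<le> C1 * sqrt (real N) \<and> degree b \<le> N2 \<and>
             (\<forall>z \<in> rays \<beta>.
                norm ((\<Sum>j = 1..N. a j / (z - pole \<beta> N j)) + poly b z - csqrt z)
                  \<le> C2 * exp (- pi * sqrt ((2 - \<beta>) * real (N + N2))))"
    if N: "N \<ge> max 1 N0" for N
  proof -
    define T where "T = Tpar \<beta> (4 * N)"
    have T: "T = sqrt h * sqrt N" unfolding T_def h_def by (rule Tpar_four_mult[OF \<beta>(2)])
    have T0: "T \<ge> 0" using h by (simp add: T)
    \<comment> \<open>Degree \<open>n\<close> gives accuracy \<open>exp (-3 T)\<close>: one factor
      \<open>exp T\<close> is lost to the weights, one to the number of terms, and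
      \<open>exp (-T)\<close> remains.\<close>
    define n where "n = nat \<lceil>3 * T / lam\<rceil>"
    define w where "w = node_weight h T"
    define p where "p = (\<lambda>j::nat. - exp (2 * (sqrt (j * h) - T)))"
    have pole: "pole \<beta> N j = of_real (p j)" for j
      unfolding pole_eq[OF \<beta>(2)] p_def T_def h_def ..
    have p1: "p j \<le> -1" if "j > N" for j
    proof -
      have "sqrt (N * h) \<le> sqrt (j * h)" using that h by (intro real_sqrt_le_mono mult_right_mono) auto
      then show ?thesis unfolding p_def T by (simp add: real_sqrt_mult mult.commute)
    qed
    have n_le: "real n \<le> C1 * sqrt N"
    proof -
      have "real n \<le> 3 * T / lam + 1" unfolding n_def using T0 lam by simp
      also have "\<dots> \<le> 3 * T / lam + 1 * sqrt N" using N by simp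
      also have "\<dots> = C1 * sqrt N" by (simp add: C1_def T distrib_right)
      finally show ?thesis .
    qed
    have \<rho>n: "\<rho> ^ n \<le> exp (- 3 * T)"
    proof -
      have "3 * T / lam \<le> real n" unfolding n_def by linarith
      then have "3 * T \<le> real n * lam" using lam by (simp add: pos_divide_le_eq)
      moreover have "\<rho> ^ n = exp (- (real n * lam))"
        using \<rho> by (simp add: lam_def exp_of_nat_mult)
      ultimately show ?thesis by simp
    qed
    have "\<forall>j. \<exists>Q. j > N \<longrightarrow> degree Q \<le> n \<and>
        (\<forall>z\<in>rays \<beta>. norm (poly Q z - of_real (p j) / (z - of_real (p j))) \<le> \<rho> ^ n / (1 - \<rho>))"
      using approx[OF p1] by blast
    then obtain Q where Q: "\<And>j. j > N \<Longrightarrow> degree (Q j) \<le> n"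
      "\<And>j z. j > N \<Longrightarrow> z \<in> rays \<beta> \<Longrightarrow> norm (poly (Q j) z - of_real (p j) / (z - of_real (p j))) \<le> \<rho> ^ n / (1 - \<rho>)"
      by metis
    \<comment> \<open>Since \<open>z / (z - p) = 1 + p / (z - p)\<close>, each node has residue
      \<open>w p\<close> and leaves the constant \<open>w\<close>. The constants of the first
      \<open>N\<close> nodes go into \<open>b\<close>, as do the replacements \<open>1 + Q\<close>
      of all later nodes.\<close>
    define a where "a = (\<lambda>j. complex_of_real (w j * p j))"
    define b where "b = (\<Sum>j=1..N. [:complex_of_real (w j):]) + (\<Sum>j\<in>{N<..4*N}. smult (of_real (w j)) (1 + Q j))"
    have deg: "degree b \<le> n"
      unfolding b_def
      by (intro degree_add_le degree_sum_le order.trans[OF degree_smult_le] Q) auto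
    have "norm ((\<Sum>j = 1..N. a j / (z - pole \<beta> N j)) + poly b z - csqrt z) \<le> (B + C) * exp (- T)"
      if z: "z \<in> rays \<beta>" for z
    proof -
      define F where "F = (\<lambda>j::nat. h * f_fun T (of_real (j * h)) z)"
      have F: "F j = of_real (w j) * (1 + of_real (p j) / (z - of_real (p j)))" if "j \<ge> 1" for j :: nat
      proof -
        have "z - of_real (p j) \<noteq> 0"
          by (rule z_minus_pole_nonzero[OF \<beta> z]) (simp add: p_def)
        then have "1 + of_real (p j) / (z - of_real (p j)) = z / (z - of_real (p j))"
          by (simp add: field_simps)
        moreover have "F j = of_real (w j) * (z / (z - of_real (p j)))"
          unfolding F_def f_fun_node[OF h that] w_def p_def by (simp add: add.commute)
        ultimately show ?thesis by simp
      qed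
      have split: "(\<Sum>j=1..4*N. F j) = (\<Sum>j=1..N. F j) + (\<Sum>j\<in>{N<..4*N}. F j)"
      proof -
        have eq: "{1..4*N} = {1..N} \<union> {N<..4*N}" using N by auto
        show ?thesis unfolding eq by (rule sum.union_disjoint) auto
      qed
      have "(\<Sum>j=1..N. F j) = (\<Sum>j = 1..N. a j / (z - pole \<beta> N j)) + (\<Sum>j=1..N. of_real (w j))"
        unfolding sum.distrib[symmetric]
        by (intro sum.cong refl) (simp add: F pole a_def distrib_left)
      moreover have "poly b z = (\<Sum>j=1..N. of_real (w j)) + (\<Sum>j\<in>{N<..4*N}. of_real (w j) * (1 + poly (Q j) z))"
        by (simp add: b_def poly_sum)
      ultimately have diff: "(\<Sum>j = 1..N. a j / (z - pole \<beta> N j)) + poly b z - (\<Sum>j=1..4*N. F j)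
          = (\<Sum>j\<in>{N<..4*N}. of_real (w j) * (1 + poly (Q j) z)) - (\<Sum>j\<in>{N<..4*N}. F j)"
        unfolding split by simp
      also have "\<dots> = (\<Sum>j\<in>{N<..4*N}. of_real (w j) * (poly (Q j) z - of_real (p j) / (z - of_real (p j))))"
        unfolding sum_subtractf[symmetric]
        by (intro sum.cong refl) (simp add: F right_diff_distrib distrib_left)
      finally have diff: "(\<Sum>j = 1..N. a j / (z - pole \<beta> N j)) + poly b z - (\<Sum>j=1..4*N. F j)
          = (\<Sum>j\<in>{N<..4*N}. of_real (w j) * (poly (Q j) z - of_real (p j) / (z - of_real (p j))))" .
      have "norm ((\<Sum>j = 1..N. a j / (z - pole \<beta> N j)) + poly b z - (\<Sum>j=1..4*N. F j))
          \<le> (\<Sum>j\<in>{N<..4*N}. sqrt h * exp T * (exp (- 3 * T) / (1 - \<rho>)))"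
        unfolding diff
      proof (rule sum_norm_le)
        fix j assume j: "j \<in> {N<..4*N}"
        have "sqrt (j * h) \<le> sqrt (4 * N * h)" using j h by (intro real_sqrt_le_mono mult_right_mono) auto
        also have "\<dots> = 2 * T" by (simp add: T real_sqrt_mult)
        finally have w: "0 \<le> w j" "w j \<le> sqrt h * exp T"
          unfolding w_def using node_weight_bounds[OF h, of j T] j by auto
        have "norm (poly (Q j) z - of_real (p j) / (z - of_real (p j))) \<le> exp (- 3 * T) / (1 - \<rho>)"
          using Q(2)[of j z] j z \<rho>n \<rho> by (intro order.trans[OF Q(2)] divide_right_mono) auto
        then show "norm (of_real (w j) * (poly (Q j) z - of_real (p j) / (z - of_real (p j))))
            \<le> sqrt h * exp T * (exp (- 3 * T) / (1 - \<rho>))"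
          unfolding norm_mult norm_of_real using w by (intro mult_mono) auto
      qed
      also have "\<dots> = 3 * N * (sqrt h * exp T * (exp (- 3 * T) / (1 - \<rho>)))" by simp
      also have "\<dots> = (3 * sqrt h / (1 - \<rho>)) * (N * (exp T * exp (- 3 * T)))" by simp
      also have "\<dots> \<le> (3 * sqrt h / (1 - \<rho>)) * (2 / h * exp T * (exp T * exp (- 3 * T)))"
      proof -
        have "T\<^sup>2 / 2 \<le> exp T" using exp_lower_Taylor_quadratic[OF T0] T0 by linarith
        moreover have "T\<^sup>2 = h * N" using h by (simp add: T power_mult_distrib)
        ultimately have "real N \<le> 2 / h * exp T" using h by (simp add: field_simps)
        then show ?thesis using h \<rho> by (intro mult_left_mono mult_right_mono) auto
      qed
      also have "\<dots> = B * (exp T * (exp T * exp (- 3 * T)))"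
      proof -
        have "3 * g / (1 - \<rho>) * (2 / (g * g) * x * y) = 6 / (g * (1 - \<rho>)) * (x * y)" if "g > 0" for g x y :: real
          using that \<rho> by (simp add: divide_simps)
        from this[of "sqrt h"] show ?thesis using h by (simp add: B_def)
      qed
      also have "exp T * (exp T * exp (- 3 * T)) = exp (- T)" by (simp flip: exp_add)
      finally have 1: "norm ((\<Sum>j = 1..N. a j / (z - pole \<beta> N j)) + poly b z - (\<Sum>j=1..4*N. F j)) \<le> B * exp (- T)" .
      have "norm ((\<Sum>j=1..4*N. F j) - csqrt z) \<le> C * exp (- T)"
        using N0[rule_format, of "4 * N" z] N z unfolding F_def T_def[symmetric] sum_distrib_left by simp
      then have "norm (((\<Sum>j = 1..N. a j / (z - pole \<beta> N j)) + poly b z - (\<Sum>j=1..4*N. F j))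
          + ((\<Sum>j=1..4*N. F j) - csqrt z)) \<le> B * exp (- T) + C * exp (- T)"
        by (rule norm_triangle_mono[OF 1])
      then show ?thesis by (simp add: distrib_right add_diff_eq)
    qed
    moreover have "(B + C) * exp (- T) \<le> C2 * exp (- pi * sqrt ((2 - \<beta>) * real (N + n)))"
    proof -
      have "(B + C) * exp (- T) \<le> (B + C) * (exp (sqrt h * C1) * exp (- pi * sqrt ((2 - \<beta>) * real (N + n))))"
        unfolding T_def h_def using B C(1) exp_Tpar_le[OF \<beta>(2) n_le C1] by (intro mult_left_mono) auto
      then show ?thesis by (simp add: C2_def mult.assoc)
    qed
    ultimately show ?thesis
      using n_le deg by (intro exI[of _ a] exI[of _ b] exI[of _ n]) (blast intro: order.trans)
  qed
  then show ?thesis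
    unfolding eventually_sequentially by blast
qed

end
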